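(* For any positive integer $n$, there exists a strongly $\mathbb Z$-graded ring $R$ such that $R_0$ has UGN and $\mathrm{gn}(R)=n$.
   Context: Rings are unital; "module" means right module. A ring $S$ has unbounded generating number (UGN) if, for every positive integer $n$, there is no $S$-module epimorphism $S^n\to S^{n+1}$. If $S$ does not have UGN, its generating number $\mathrm{gn}(S)$ is the smallest positive integer $n$ for which there is an $S$-module epimorphism $S^n\to S^{n+1}$; if $S$ has UGN, $\mathrm{gn}(S):=\aleph_0$. A ring $R$ is strongly $\mathbb Z$-graded if there are additive subgroups $R_k$ ($k\in\mathbb Z$) with $R=\bigoplus_{k\in\mathbb Z}R_k$ as additive groups and $R_kR_l=R_{k+l}$ for all $k,l\in\mathbb Z$, where $R_kR_l$ is the additive subgroup generated by products. $R_0$ is the base ring. *)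

theory Defs
  imports "HOL-Algebra.Algebra" "HOL-Library.Extended_Nat"
begin

text \<open>
  The locale \<^locale>\<open>module\<close> of the library covers left modules over commutative rings only.
  As there, the multiplicative fields of the record of a module are not used.
\<close>

record ('a, 'b) right_module = "'b ring" +
  rsmult :: "['b, 'a] \<Rightarrow> 'b" (infixl \<open>\<bullet>\<index>\<close> 70)

locale right_module = R?: ring S + M?: abelian_group M
  for S :: "('a, 'r) ring_scheme" (structure) and M :: "('a, 'b, 'm) right_module_scheme" (structure) +
  assumes rsmult_closed: "\<lbrakk>x \<in> carrier M; a \<in> carrier S\<rbrakk> \<Longrightarrow> x \<bullet>\<^bsub>M\<^esub> a \<in> carrier M"
    and rsmult_l_distr: "\<lbrakk>x \<in> carrier M; y \<in> carrier M; a \<in> carrier S\<rbrakk> \<Longrightarrow>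
      (x \<oplus>\<^bsub>M\<^esub> y) \<bullet>\<^bsub>M\<^esub> a = x \<bullet>\<^bsub>M\<^esub> a \<oplus>\<^bsub>M\<^esub> y \<bullet>\<^bsub>M\<^esub> a"
    and rsmult_r_distr: "\<lbrakk>x \<in> carrier M; a \<in> carrier S; b \<in> carrier S\<rbrakk> \<Longrightarrow>
      x \<bullet>\<^bsub>M\<^esub> (a \<oplus>\<^bsub>S\<^esub> b) = x \<bullet>\<^bsub>M\<^esub> a \<oplus>\<^bsub>M\<^esub> x \<bullet>\<^bsub>M\<^esub> b"
    and rsmult_assoc: "\<lbrakk>x \<in> carrier M; a \<in> carrier S; b \<in> carrier S\<rbrakk> \<Longrightarrow>
      x \<bullet>\<^bsub>M\<^esub> (a \<otimes>\<^bsub>S\<^esub> b) = (x \<bullet>\<^bsub>M\<^esub> a) \<bullet>\<^bsub>M\<^esub> b"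
    and rsmult_one: "x \<in> carrier M \<Longrightarrow> x \<bullet>\<^bsub>M\<^esub> \<one>\<^bsub>S\<^esub> = x"

definition right_module_hom ::
  "('a, 'r) ring_scheme \<Rightarrow> ('a, 'b, 'm) right_module_scheme \<Rightarrow> ('a, 'c, 'n) right_module_scheme
    \<Rightarrow> ('b \<Rightarrow> 'c) set" where
  "right_module_hom S M N =
    {f \<in> carrier M \<rightarrow> carrier N.
      (\<forall>x\<in>carrier M. \<forall>y\<in>carrier M. f (x \<oplus>\<^bsub>M\<^esub> y) = f x \<oplus>\<^bsub>N\<^esub> f y) \<and>
      (\<forall>x\<in>carrier M. \<forall>a\<in>carrier S. f (x \<bullet>\<^bsub>M\<^esub> a) = f x \<bullet>\<^bsub>N\<^esub> a)}"

definition right_module_epi ::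
  "('a, 'r) ring_scheme \<Rightarrow> ('a, 'b, 'm) right_module_scheme \<Rightarrow> ('a, 'c, 'n) right_module_scheme
    \<Rightarrow> ('b \<Rightarrow> 'c) set" where
  "right_module_epi S M N = {f \<in> right_module_hom S M N. f ` carrier M = carrier N}"

text \<open>The free right module \<open>S\<^sup>n\<close>, with coordinates indexed by \<open>{..<n}\<close>.\<close>

definition free_right_module :: "('a, 'r) ring_scheme \<Rightarrow> nat \<Rightarrow> ('a, nat \<Rightarrow> 'a) right_module" where
  "free_right_module S n =
    \<lparr>carrier = {..<n} \<rightarrow>\<^sub>E carrier S,
     monoid.mult = undefined, one = undefined,
     ring.zero = (\<lambda>i\<in>{..<n}. \<zero>\<^bsub>S\<^esub>),
     ring.add = (\<lambda>x y. \<lambda>i\<in>{..<n}. x i \<oplus>\<^bsub>S\<^esub> y i),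
     rsmult = (\<lambda>x a. \<lambda>i\<in>{..<n}. x i \<otimes>\<^bsub>S\<^esub> a)\<rparr>"

lemma right_module_free_right_module:
  assumes "ring S"
  shows "right_module S (free_right_module S n)"
proof -
  interpret S: ring S by fact
  have "abelian_group (free_right_module S n)"
  proof (rule abelian_groupI)
    fix x assume x: "x \<in> carrier (free_right_module S n)"
    show "\<exists>y\<in>carrier (free_right_module S n).
        y \<oplus>\<^bsub>free_right_module S n\<^esub> x = \<zero>\<^bsub>free_right_module S n\<^esub>"
      using x
      by (intro bexI[of _ "\<lambda>i\<in>{..<n}. \<ominus>\<^bsub>S\<^esub> x i"])
         (auto simp: free_right_module_def PiE_iff fun_eq_iff restrict_def extensional_def S.l_neg)
  qed (auto simp: free_right_module_def PiE_iff fun_eq_iff restrict_def extensional_def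
      S.a_ac)
  then show ?thesis
    by (intro right_module.intro right_module_axioms.intro assms)
       (auto simp: free_right_module_def PiE_iff fun_eq_iff restrict_def extensional_def
          S.l_distr S.r_distr S.m_assoc)
qed

definition UGN :: "('a, 'r) ring_scheme \<Rightarrow> bool" where
  "UGN S \<longleftrightarrow>
    (\<forall>n>0. right_module_epi S (free_right_module S n) (free_right_module S (n + 1)) = {})"

text \<open>The generating number; the value \<open>\<infinity>\<close> stands for \<open>\<aleph>\<^sub>0\<close>.\<close>

definition gn :: "('a, 'r) ring_scheme \<Rightarrow> enat" where
  "gn S =
    (if UGN S then \<infinity>
     else enat (LEAST n. n > 0 \<and>
       right_module_epi S (free_right_module S n) (free_right_module S (n + 1)) \<noteq> {}))"

text \<open>
  In the locale below, \<open>decomp\<close> says that \<open>R\<close> is the internal direct sum of the \<open>G k\<close>: every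
  element has a unique family of homogeneous components, almost all of which vanish.
\<close>

locale strongly_Z_graded_ring = ring R for R (structure) +
  fixes G :: "int \<Rightarrow> 'a set"
  assumes component: "additive_subgroup (G k) R"
    and decomp: "x \<in> carrier R \<Longrightarrow>
      \<exists>!c. (\<forall>k. c k \<in> G k) \<and> finite {k. c k \<noteq> \<zero>} \<and> x = (\<Oplus>k\<in>{k. c k \<noteq> \<zero>}. c k)"
    and strong: "generate (add_monoid R) (G k <#> G l) = G (k + l)"

definition base_ring :: "('a, 'r) ring_scheme \<Rightarrow> (int \<Rightarrow> 'a set) \<Rightarrow> ('a, 'r) ring_scheme" where
  "base_ring R G = R\<lparr>carrier := G 0\<rparr>"

context strongly_Z_graded_ring
begin

lemma component_closed: "x \<in> G k \<Longrightarrow> x \<in> carrier R"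
  using additive_subgroup.a_subset[OF component] by blast

lemma component_zero: "\<zero> \<in> G k"
  using additive_subgroup.zero_closed[OF component] .

lemma mult_component: "x \<in> G k \<Longrightarrow> y \<in> G l \<Longrightarrow> x \<otimes> y \<in> G (k + l)"
  unfolding strong[symmetric] by (rule generate.incl) (auto simp: set_mult_def)

lemma finsum_support:
  assumes "finite A" "\<And>k. c k \<in> carrier R" "\<And>k. k \<notin> A \<Longrightarrow> c k = \<zero>"
  shows "(\<Oplus>k\<in>{k. c k \<noteq> \<zero>}. c k) = (\<Oplus>k\<in>A. c k)"
  by (rule add.finprod_mono_neutral_cong_left) (use assms in auto)

lemma decomp_unique:
  assumes "\<And>k. c k \<in> G k" "\<And>k. d k \<in> G k" "finite A" "finite B"
    "\<And>k. k \<notin> A \<Longrightarrow> c k = \<zero>" "\<And>k. k \<notin> B \<Longrightarrow> d k = \<zero>"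
    "(\<Oplus>k\<in>A. c k) = (\<Oplus>k\<in>B. d k)"
  shows "c = d"
proof -
  have cc: "c k \<in> carrier R" and dc: "d k \<in> carrier R" for k
    using assms(1,2) component_closed by blast+
  have c: "finite {k. c k \<noteq> \<zero>}" "(\<Oplus>k\<in>{k. c k \<noteq> \<zero>}. c k) = (\<Oplus>k\<in>A. c k)"
    by (rule finite_subset[OF _ assms(3)], use assms(5) in blast)
       (rule finsum_support[OF assms(3) cc assms(5)])
  have d: "finite {k. d k \<noteq> \<zero>}" "(\<Oplus>k\<in>{k. d k \<noteq> \<zero>}. d k) = (\<Oplus>k\<in>B. d k)"
    by (rule finite_subset[OF _ assms(4)], use assms(6) in blast)
       (rule finsum_support[OF assms(4) dc assms(6)])
  have "(\<Oplus>k\<in>A. c k) \<in> carrier R"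
    using cc by (intro finsum_closed) auto
  from decomp[OF this] show ?thesis
  proof (rule Uniq_D[OF ex1_iff_ex_Uniq[THEN iffD1, THEN conjunct2]])
    show "(\<forall>k. c k \<in> G k) \<and> finite {k. c k \<noteq> \<zero>} \<and>
        (\<Oplus>k\<in>A. c k) = (\<Oplus>k\<in>{k. c k \<noteq> \<zero>}. c k)"
      using assms(1) c by simp
    show "(\<forall>k. d k \<in> G k) \<and> finite {k. d k \<noteq> \<zero>} \<and>
        (\<Oplus>k\<in>A. c k) = (\<Oplus>k\<in>{k. d k \<noteq> \<zero>}. d k)"
      using assms(2,7) d by simp
  qed
qed

lemma one_base: "\<one> \<in> G 0"
proof -
  obtain c where c: "\<And>k. c k \<in> G k" "finite {k. c k \<noteq> \<zero>}" "\<one> = (\<Oplus>k\<in>{k. c k \<noteq> \<zero>}. c k)"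
    using decomp[OF one_closed] by blast
  define A where "A = {k. c k \<noteq> \<zero>}"
  have cc: "c k \<in> carrier R" for k using c(1) component_closed by blast
  have r_unit: "x \<otimes> c 0 = x" if x: "x \<in> G l" for x l
  proof -
    have xc: "x \<in> carrier R" using x component_closed by blast
    have "x = x \<otimes> (\<Oplus>k\<in>A. c k)"
      unfolding A_def c(3)[symmetric] using xc by simp
    also have "\<dots> = (\<Oplus>k\<in>A. x \<otimes> c k)"
      using xc cc c(2) by (intro finsum_rdistr) (auto simp: A_def)
    also have "\<dots> = (\<Oplus>k\<in>A. x \<otimes> c (k + l - l))" by simp
    also have "\<dots> = (\<Oplus>k\<in>(\<lambda>k. k + l) ` A. x \<otimes> c (k - l))"
      using xc cc by (subst add.finprod_reindex) (auto simp: inj_on_def)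
    finally have sum: "(\<Oplus>k\<in>(\<lambda>k. k + l) ` A. x \<otimes> c (k - l)) = x" by simp
    have "(\<lambda>k. x \<otimes> c (k - l)) = (\<lambda>k. if k = l then x else \<zero>)"
    proof (rule decomp_unique)
      show "x \<otimes> c (k - l) \<in> G k" for k
        using mult_component[OF x c(1), of "k - l"] by simp
      show "(if k = l then x else \<zero>) \<in> G k" for k using x component_zero by simp
      show "finite ((\<lambda>k. k + l) ` A)" using c(2) by (simp add: A_def)
      show "finite {l}" by simp
      show "x \<otimes> c (k - l) = \<zero>" if "k \<notin> (\<lambda>k. k + l) ` A" for k
      proof -
        have "k - l \<notin> A"
        proof
          assume "k - l \<in> A"
          then have "(k - l) + l \<in> (\<lambda>k. k + l) ` A" by (rule imageI)
          with that show False by simp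
        qed
        then show ?thesis using xc by (simp add: A_def)
      qed
      show "(if k = l then x else \<zero>) = \<zero>" if "k \<notin> {l}" for k using that by simp
      show "(\<Oplus>k\<in>(\<lambda>k. k + l) ` A. x \<otimes> c (k - l)) = (\<Oplus>k\<in>{l}. if k = l then x else \<zero>)"
        using sum xc by simp
    qed
    from fun_cong[OF this, of l] show ?thesis by simp
  qed
  have "c 0 = (\<Oplus>k\<in>A. c k) \<otimes> c 0"
    unfolding A_def c(3)[symmetric] using cc by simp
  also have "\<dots> = (\<Oplus>k\<in>A. c k \<otimes> c 0)"
    using cc c(2) by (intro finsum_ldistr) (auto simp: A_def)
  also have "\<dots> = (\<Oplus>k\<in>A. c k)" using r_unit[OF c(1)] by simp
  finally show ?thesis using c(1)[of 0] c(3) by (simp add: A_def)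
qed

lemma subring_base: "subring (G 0) R"
proof (rule ring.subringI[OF ring_axioms])
  show "G 0 \<subseteq> carrier R" using component_closed by blast
  show "\<one> \<in> G 0" by (rule one_base)
  show "\<ominus> h \<in> G 0" if "h \<in> G 0" for h
    using additive_subgroup.a_inv_closed[OF component that] .
  show "h1 \<otimes> h2 \<in> G 0" if "h1 \<in> G 0" "h2 \<in> G 0" for h1 h2
    using mult_component[OF that] by simp
  show "h1 \<oplus> h2 \<in> G 0" if "h1 \<in> G 0" "h2 \<in> G 0" for h1 h2
    using additive_subgroup.a_closed[OF component that] .
qed

lemma ring_base_ring: "ring (base_ring R G)"
  unfolding base_ring_def by (rule subring_is_ring[OF subring_base])

end

end

theory Submission
  imports Defs "HOL-Library.Poly_Mapping" "HOL-Library.Z2" "HOL-Library.Countable_Set"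
begin

text \<open>
  Let \<open>F\<close> be the free algebra over the field with two elements on letters \<open>x\<^sub>i\<^sub>r\<close>, \<open>y\<^sub>r\<^sub>j\<close>, \<open>u\<^sub>i\<close>, \<open>v\<^sub>i\<close>,
  graded by giving degree \<open>1\<close> to the \<open>x\<^sub>i\<^sub>r\<close> and \<open>v\<^sub>i\<close> and degree \<open>-1\<close> to the \<open>y\<^sub>r\<^sub>j\<close> and \<open>u\<^sub>i\<close>. Let \<open>X\<close>
  and \<open>Y\<close> be the generic matrices of sizes \<open>(n + 1) \<times> n\<close> and \<open>n \<times> (n + 1)\<close> with entries \<open>x\<^sub>i\<^sub>r\<close>
  and \<open>y\<^sub>r\<^sub>j\<close>. The ring is \<open>R = F / J\<close>, where \<open>J\<close> is the largest graded ideal that is contained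
  in the intersection of two ideals of \<open>F\<close>:

  \<^item> the preimage of \<open>I\<close> under the specialization of \<open>u\<^sub>0\<close>, \<open>v\<^sub>0\<close> to \<open>1\<close> and of the other \<open>u\<^sub>i\<close>, \<open>v\<^sub>i\<close>
    to \<open>0\<close>, where \<open>I\<close> contains the entries of \<open>X Y - 1\<close>;

  \<^item> the annihilator of a representation on the space with basis \<open>e\<^sub>0, e\<^sub>1, \<dots>\<close> in which \<open>y\<^sub>0\<^sub>j\<close> and
    \<open>u\<^sub>j\<close> map \<open>e\<^sub>k\<close> to \<open>e\<^sub>m\<^sub>k\<^sub>+\<^sub>j\<close> for \<open>m = n + 1\<close>, in which \<open>x\<^sub>j\<^sub>0\<close> and \<open>v\<^sub>j\<close> act as the transposed
    operators, and in which the \<open>x\<^sub>i\<^sub>r\<close> and \<open>y\<^sub>r\<^sub>j\<close> with \<open>r > 0\<close> act as zero.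

  Both ideals contain the entries of \<open>X Y - 1\<close> and the element \<open>u\<^sub>0 v\<^sub>0 + \<dots> + u\<^sub>n v\<^sub>n - 1\<close>. These
  are homogeneous of degree zero, so they belong to \<open>J\<close>. Hence \<open>1\<close> lies in \<open>R\<^sub>1 R\<^sub>-\<^sub>1\<close> and in
  \<open>R\<^sub>-\<^sub>1 R\<^sub>1\<close>, which makes \<open>R\<close> strongly graded, and \<open>X Y = 1\<close> over \<open>R\<close> shows that \<open>gn(R) \<le> n\<close>.

  The base ring has UGN because elements of degree zero act locally finitely: finitely many of
  them preserve the span of \<open>e\<^sub>k\<close> for \<open>k < m\<^sup>p\<close> if \<open>p\<close> is large, and an identity \<open>A B = 1\<close> of
  matrices of sizes \<open>(k + 1) \<times> k\<close> and \<open>k \<times> (k + 1)\<close> would contradict the rank inequality over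
  the field (\<open>no_identity_factorization_degree_zero\<close>).

  The inequality \<open>gn(R) \<ge> n\<close> follows from the same statement for \<open>F / I\<close>, in the range \<open>k < n\<close>
  (\<open>no_identity_factorization_I1\<close>). It rests on a weak algorithm in the sense of P. M. Cohn for
  the filtration by length (\<open>weak_algorithm\<close>): if fewer than \<open>n\<close> elements satisfy a nontrivial
  relation with coefficients on the right, then the degree of one of them can be lowered by
  subtracting a right linear combination of the others. So the first row of \<open>A\<close> can be reduced
  by elementary column operations until its nonzero entries meet only zeros in all columns of
  \<open>B\<close> but the first. Then one index of each kind can be removed, and induction on \<open>k\<close> applies. The weak algorithm is deduced from its graded analogue (\<open>graded_weak_algorithm\<close>) for
  \<open>F / I\<^sub>0\<close>, where \<open>I\<^sub>0\<close> is generated by the entries of \<open>X Y\<close>. To this end one needs that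
  the leading forms of the elements of \<open>I\<close> belong to \<open>I\<^sub>0\<close>. This is achieved without normal forms:
  \<open>F\<close> acts on itself such that each entry of \<open>X Y - 1\<close> acts as the left multiplication by the
  corresponding entry of \<open>X Y\<close>, and \<open>I\<close> is defined as the annihilator of \<open>F / I\<^sub>0\<close> under this
  action.
\<close>

section \<open>Linear algebra over a field\<close>

lemma exists_linear_dependence:
  fixes v :: "'s \<Rightarrow> 'r \<Rightarrow> 'k::field"
  assumes "finite S" "finite M" "card S < card M"
  shows "\<exists>g. (\<exists>r\<in>M. g r \<noteq> 0) \<and> (\<forall>s\<in>S. (\<Sum>r\<in>M. g r * v s r) = 0)"
  using assms
proof (induction S arbitrary: M v rule: finite_induct)
  case empty
  then have "M \<noteq> {}" by auto
  then show ?case by (intro exI[of _ "\<lambda>_. 1"]) auto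
next
  case (insert s S)
  show ?case
  proof (cases "\<exists>p\<in>M. v s p \<noteq> 0")
    case False
    have "card S < card M" using insert by simp
    from insert.IH[OF insert.prems(1) this, of v] obtain g where
      g: "\<exists>r\<in>M. g r \<noteq> 0" "\<forall>s\<in>S. (\<Sum>r\<in>M. g r * v s r) = 0" by blast
    moreover have "(\<Sum>r\<in>M. g r * v s r) = 0" using False by (intro sum.neutral) auto
    ultimately show ?thesis by (intro exI[of _ g]) auto
  next
    case True
    then obtain p where p: "p \<in> M" "v s p \<noteq> 0" by blast
    define u where "u t r = v t r - v t p * v s r / v s p" for t r
    have "card S < card (M - {p})" using insert p by simp
    from insert.IH[OF _ this, of u] insert.prems(1) obtain g where
      g: "\<exists>r\<in>M - {p}. g r \<noteq> 0" "\<forall>t\<in>S. (\<Sum>r\<in>M - {p}. g r * u t r) = 0" by auto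
    define c where "c = - (\<Sum>r\<in>M - {p}. g r * v s r) / v s p"
    define g' where "g' r = (if r = p then c else g r)" for r
    have split: "(\<Sum>r\<in>M. g' r * v t r) = c * v t p + (\<Sum>r\<in>M - {p}. g r * v t r)" for t
      using p insert.prems(1) by (subst sum.remove[of M p]) (auto simp: g'_def intro!: sum.cong)
    have "(\<Sum>r\<in>M. g' r * v s r) = 0"
      unfolding split c_def using p by simp
    moreover have "(\<Sum>r\<in>M. g' r * v t r) = 0" if "t \<in> S" for t
    proof -
      have "0 = (\<Sum>r\<in>M - {p}. g r * u t r)" using g that by simp
      also have "\<dots> = (\<Sum>r\<in>M - {p}. g r * v t r) - (\<Sum>r\<in>M - {p}. g r * v s r) * (v t p / v s p)"
        by (simp add: u_def sum_subtractf sum_distrib_left sum_divide_distrib algebra_simps)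
      finally show ?thesis unfolding split c_def by (simp add: field_simps)
    qed
    moreover have "\<exists>r\<in>M. g' r \<noteq> 0" using g by (auto simp: g'_def)
    ultimately show ?thesis by (intro exI[of _ g']) auto
  qed
qed

lemma identity_matrix_factorization_field:
  fixes A :: "'r \<Rightarrow> 's \<Rightarrow> 'k::field"
  assumes "finite S" "finite M"
    and AB: "\<And>i j. i \<in> M \<Longrightarrow> j \<in> M \<Longrightarrow> (\<Sum>s\<in>S. A i s * B s j) = (if i = j then 1 else 0)"
  shows "card M \<le> card S"
proof (rule ccontr)
  assume "\<not> ?thesis"
  then have "card S < card M" by simp
  from exists_linear_dependence[OF assms(1,2) this, of "\<lambda>s r. A r s"] obtain g where
    g: "\<exists>r\<in>M. g r \<noteq> 0" "\<forall>s\<in>S. (\<Sum>r\<in>M. g r * A r s) = 0" by blast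
  then obtain j where j: "j \<in> M" "g j \<noteq> 0" by blast
  have "g j = (\<Sum>r\<in>M. g r * (if r = j then 1 else 0))"
    using j assms(2) by (simp add: if_distrib[of "(*) _"] sum.delta cong: if_cong)
  also have "\<dots> = (\<Sum>r\<in>M. \<Sum>s\<in>S. g r * A r s * B s j)"
    using AB j by (auto simp: sum_distrib_left mult.assoc simp flip: AB intro!: sum.cong)
  also have "\<dots> = (\<Sum>s\<in>S. (\<Sum>r\<in>M. g r * A r s) * B s j)"
    by (subst sum.swap) (simp add: sum_distrib_right)
  also have "\<dots> = 0" using g by simp
  finally show False using j by simp
qed

section \<open>Free modules and free algebras as finitely supported functions\<close>

abbreviation lookup :: "('a \<Rightarrow>\<^sub>0 'b::zero) \<Rightarrow> 'a \<Rightarrow> 'b" where "lookup \<equiv> Poly_Mapping.lookup"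
abbreviation keys :: "('a \<Rightarrow>\<^sub>0 'b::zero) \<Rightarrow> 'a set" where "keys \<equiv> Poly_Mapping.keys"
abbreviation single :: "'a \<Rightarrow> 'b::zero \<Rightarrow> 'a \<Rightarrow>\<^sub>0 'b" where "single \<equiv> Poly_Mapping.single"

text \<open>
  With concatenation as addition and the empty list as zero, the lists over \<open>'z\<close> form the free monoid, and
  \<open>'z list \<Rightarrow>\<^sub>0 'k\<close> is the free algebra over \<open>'k\<close> on the letters \<open>'z\<close>.
\<close>

instantiation list :: (type) monoid_add
begin

definition zero_list :: "'a list" where "zero_list = []"
definition plus_list :: "'a list \<Rightarrow> 'a list \<Rightarrow> 'a list" where "plus_list = (@)"

instance by standard (simp_all add: zero_list_def plus_list_def)

end

type_synonym ('z, 'k) free_algebra = "'z list \<Rightarrow>\<^sub>0 'k"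

lemma poly_mapping_additive_induct [case_names zero single add]:
  fixes f :: "'a \<Rightarrow>\<^sub>0 'b::comm_monoid_add"
  assumes "P 0" "\<And>w c. P (single w c)" "\<And>f g. P f \<Longrightarrow> P g \<Longrightarrow> P (f + g)"
  shows "P f"
proof (induction f rule: Poly_Mapping.update_induct)
  case const
  show ?case by fact
next
  case (update f a b)
  have "Poly_Mapping.update a b f = single a b + f"
    using update(1)
    by (intro poly_mapping_eqI)
       (auto simp: lookup_update lookup_add lookup_single in_keys_iff when_def)
  then show ?case using assms update by simp
qed

lemma inj_keys_bit: "inj (keys :: ('a \<Rightarrow>\<^sub>0 bit) \<Rightarrow> 'a set)"
proof (rule injI, rule poly_mapping_eqI)
  fix f g :: "'a \<Rightarrow>\<^sub>0 bit" and x
  assume "keys f = keys g"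
  then have "(lookup f x = 0) = (lookup g x = 0)" by (metis in_keys_iff)
  then show "lookup f x = lookup g x" by (cases "lookup f x"; cases "lookup g x") auto
qed

lemma countable_poly_mapping_bit: "countable (UNIV :: ('a::countable \<Rightarrow>\<^sub>0 bit) set)"
proof -
  have "countable (range (keys :: ('a \<Rightarrow>\<^sub>0 bit) \<Rightarrow> 'a set))"
    by (rule countable_subset[OF _ countable_Collect_finite]) auto
  then show ?thesis using countable_image_inj_on inj_keys_bit by blast
qed

text \<open>Scalar multiplication.\<close>

definition scale :: "'k \<Rightarrow> ('x \<Rightarrow>\<^sub>0 'k) \<Rightarrow> ('x \<Rightarrow>\<^sub>0 'k::ring_1)" where
  "scale c f = Poly_Mapping.map ((*) c) f"

lemma lookup_scale [simp]: "lookup (scale c f) x = c * lookup f x"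
  by (simp add: scale_def map.rep_eq when_def)

lemma scale_simps [simp]:
  "scale c 0 = 0" "scale 0 f = 0" "scale 1 f = f" "scale c (scale d f) = scale (c * d) f"
  by (rule poly_mapping_eqI; simp add: mult.assoc)+

lemma scale_single: "scale c (single x d) = single x (c * d)"
  by (rule poly_mapping_eqI) (simp add: lookup_single when_def)

lemma scale_add: "scale c (f + g) = scale c f + scale c g"
  by (rule poly_mapping_eqI) (simp add: lookup_add algebra_simps)

lemma scale_add_left: "scale (c + d) f = scale c f + scale d f"
  by (rule poly_mapping_eqI) (simp add: lookup_add algebra_simps)

lemma scale_diff: "scale c (f - g) = scale c f - scale c g"
  by (rule poly_mapping_eqI) (simp add: lookup_minus algebra_simps)

lemma scale_uminus: "scale (- c) f = - scale c f"
  by (rule poly_mapping_eqI) simp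

lemma scale_sum: "scale c (sum f A) = (\<Sum>a\<in>A. scale c (f a))"
  by (induction A rule: infinite_finite_induct) (simp_all add: scale_add)

lemma scale_eq_mult: "scale c f = single [] c * f"
  unfolding scale_def mult_map_scale_conv_mult zero_list_def ..

lemma scale_mult: "scale c f * g = scale c (f * g)"
  for f g :: "('z, 'k::ring_1) free_algebra"
  by (simp add: scale_eq_mult mult.assoc)

lemma mult_scale: "f * scale c g = scale c (f * g)"
  for f g :: "('z, 'k::comm_ring_1) free_algebra"
proof -
  have "f * single [] c = single [] c * f" for f :: "('z, 'k) free_algebra"
    by (induction f rule: poly_mapping_additive_induct)
       (simp_all add: mult_single plus_list_def mult.commute algebra_simps)
  then show ?thesis by (simp add: scale_eq_mult flip: mult.assoc)
qed

text \<open>The basis vector of the free module that corresponds to \<open>w\<close>; a monomial if \<open>w\<close> is a word.\<close>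

abbreviation mon :: "'x \<Rightarrow> 'x \<Rightarrow>\<^sub>0 'k::zero_neq_one" where "mon w \<equiv> single w 1"

lemma mon_mult [simp]: "mon u * mon v = (mon (u @ v) :: ('z, 'k::ring_1) free_algebra)"
  by (simp add: mult_single plus_list_def)

lemma mon_Nil: "mon [] = (1 :: ('z, 'k::ring_1) free_algebra)"
  by (metis single_one zero_list_def)

lemma linear_induct [case_names zero mon scale add]:
  fixes f :: "'x \<Rightarrow>\<^sub>0 'k::ring_1"
  assumes "P 0" "\<And>w. P (mon w)" "\<And>c f. P f \<Longrightarrow> P (scale c f)" "\<And>f g. P f \<Longrightarrow> P g \<Longrightarrow> P (f + g)"
  shows "P f"
proof (induction f rule: poly_mapping_additive_induct)
  case (single w c)
  show ?case using assms(3)[OF assms(2)[of w], of c] by (simp add: scale_single)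
qed (use assms in auto)

text \<open>The linear extension of a map defined on a basis.\<close>

definition lin :: "('w \<Rightarrow> ('x \<Rightarrow>\<^sub>0 'k)) \<Rightarrow> ('w \<Rightarrow>\<^sub>0 'k) \<Rightarrow> ('x \<Rightarrow>\<^sub>0 'k::comm_ring_1)" where
  "lin h f = (\<Sum>w\<in>keys f. scale (lookup f w) (h w))"

lemma lin_superset:
  assumes "finite A" "keys f \<subseteq> A"
  shows "lin h f = (\<Sum>w\<in>A. scale (lookup f w) (h w))"
  unfolding lin_def using assms
  by (intro sum.mono_neutral_left) (auto simp: in_keys_iff)

lemma lin_zero [simp]: "lin h 0 = 0"
  by (simp add: lin_def)

lemma lin_add: "lin h (f + g) = lin h f + lin h g"
proof -
  have "keys (f + g) \<subseteq> keys f \<union> keys g" by (rule keys_add)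
  then show ?thesis
    by (simp add: lin_superset[of "keys f \<union> keys g"] lookup_add scale_add_left sum.distrib)
qed

lemma lin_single [simp]: "lin h (single w c) = scale c (h w)"
  by (simp add: lin_def)

lemma lin_scale: "lin h (scale c f) = scale c (lin h f)"
  by (induction f rule: poly_mapping_additive_induct) (simp_all add: lin_add scale_add scale_single)

lemma lin_uminus: "lin h (- f) = - lin h f"
  using lin_add[of h f "- f"] by (simp add: eq_neg_iff_add_eq_0 add.commute)

lemma lin_diff: "lin h (f - g) = lin h f - lin h g"
  using lin_add[of h f "- g"] by (simp add: lin_uminus)

lemma lin_sum: "lin h (sum f A) = (\<Sum>a\<in>A. lin h (f a))"
  by (induction A rule: infinite_finite_induct) (simp_all add: lin_add)

section \<open>Actions of free algebras\<close>

text \<open>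
  A family \<open>a\<close> of linear maps indexed by the letters makes the free module \<open>'x \<Rightarrow>\<^sub>0 'k\<close> a left
  module over the free algebra. Here \<open>a z x\<close> is the image of the basis vector \<open>x\<close> under the
  letter \<open>z\<close>.
\<close>

definition act :: "('z \<Rightarrow> 'x \<Rightarrow> ('x \<Rightarrow>\<^sub>0 'k)) \<Rightarrow> ('z, 'k) free_algebra \<Rightarrow> ('x \<Rightarrow>\<^sub>0 'k) \<Rightarrow> ('x \<Rightarrow>\<^sub>0 'k::comm_ring_1)"
  where "act a f v = lin (\<lambda>w. foldr (\<lambda>z. lin (a z)) w v) f"

lemma act_zero_left [simp]: "act a 0 v = 0"
  by (simp add: act_def)

lemma act_add_left: "act a (f + g) v = act a f v + act a g v"
  by (simp add: act_def lin_add)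

lemma act_diff_left: "act a (f - g) v = act a f v - act a g v"
  by (simp add: act_def lin_diff)

lemma act_scale_left: "act a (scale c f) v = scale c (act a f v)"
  by (simp add: act_def lin_scale)

lemma act_sum_left: "act a (sum f A) v = (\<Sum>i\<in>A. act a (f i) v)"
  by (simp add: act_def lin_sum)

lemma act_Nil [simp]: "act a (mon []) v = v"
  by (simp add: act_def)

lemma act_Cons: "act a (mon (z # w)) v = lin (a z) (act a (mon w) v)"
  by (simp add: act_def)

lemma act_one [simp]: "act a 1 v = v"
  using act_Nil[of a v] by (simp add: mon_Nil)

lemma act_add: "act a f (v + v') = act a f v + act a f v'"
proof -
  have w: "act a (mon w) (v + v') = act a (mon w) v + act a (mon w) v'" for w
    by (induction w) (simp_all add: act_Cons lin_add)
  show ?thesis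
    by (induction f rule: linear_induct)
       (simp_all add: act_scale_left w act_add_left scale_add)
qed

lemma act_zero [simp]: "act a f 0 = 0"
  using act_add[of a f 0 0] by simp

lemma act_sum: "act a f (sum v A) = (\<Sum>i\<in>A. act a f (v i))"
  by (induction A rule: infinite_finite_induct) (simp_all add: act_add)

lemma act_scale: "act a f (scale c v) = scale c (act a f v)"
proof -
  have w: "act a (mon w) (scale c v) = scale c (act a (mon w) v)" for w
    by (induction w) (simp_all add: act_Cons lin_scale)
  show ?thesis
    by (induction f rule: linear_induct)
       (simp_all add: act_scale_left w act_add_left scale_add mult.commute)
qed

lemma act_mult: "act a (f * g) v = act a f (act a g v)"
proof -
  have w: "act a (mon u * mon w) v = act a (mon u) (act a (mon w) v)" for u w
    unfolding mon_mult by (induction u) (simp_all add: act_Cons)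
  have w': "act a (mon u * g) v = act a (mon u) (act a g v)" for u
    by (induction g rule: linear_induct)
       (simp_all only: mult_zero_right act_zero_left act_zero mult_scale
         act_scale_left act_scale w distrib_left act_add_left act_add)
  show ?thesis
    by (induction f rule: linear_induct)
       (simp_all only: mult_zero_left act_zero_left scale_mult
         act_scale_left w' distrib_right act_add_left)
qed

section \<open>Homogeneous components\<close>

text \<open>The homogeneous elements of degree \<open>k\<close> with respect to a grading \<open>d\<close> of the basis.\<close>

definition homog :: "('w \<Rightarrow> 'd) \<Rightarrow> 'd \<Rightarrow> ('w \<Rightarrow>\<^sub>0 'k::zero) set" where
  "homog d k = {f. \<forall>w\<in>keys f. d w = k}"

lemma lookup_homog: "f \<in> homog d k \<Longrightarrow> d w \<noteq> k \<Longrightarrow> lookup f w = 0"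
  by (auto simp: homog_def in_keys_iff Ball_def)

text \<open>The homogeneous component of degree \<open>k\<close>.\<close>

lift_definition part :: "('w \<Rightarrow> 'd) \<Rightarrow> 'd \<Rightarrow> ('w \<Rightarrow>\<^sub>0 'k::zero) \<Rightarrow> ('w \<Rightarrow>\<^sub>0 'k)" is
  "\<lambda>d k f w. if d w = k then f w else 0"
  by (erule rev_finite_subset) auto

lemma lookup_part: "lookup (part d k f) w = (if d w = k then lookup f w else 0)"
  by transfer simp

lemma part_zero [simp]: "part d k 0 = 0"
  by (rule poly_mapping_eqI) (simp add: lookup_part)

lemma part_add: "part d k (f + g) = part d k f + part d k g"
  by (rule poly_mapping_eqI) (simp add: lookup_part lookup_add)

lemma part_diff: "part d k (f - g) = part d k f - part d k g"
  for f :: "'w \<Rightarrow>\<^sub>0 'k::ab_group_add"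
  by (rule poly_mapping_eqI) (simp add: lookup_part lookup_minus)

lemma part_scale: "part d k (scale c f) = scale c (part d k f)"
  by (rule poly_mapping_eqI) (simp add: lookup_part)

lemma part_sum: "part d k (sum f A) = (\<Sum>a\<in>A. part d k (f a))"
  for f :: "'a \<Rightarrow> 'w \<Rightarrow>\<^sub>0 'k::comm_monoid_add"
  by (induction A rule: infinite_finite_induct) (simp_all add: part_add)

lemma part_single: "part d k (single w c) = (if d w = k then single w c else 0)"
  by (rule poly_mapping_eqI) (simp add: lookup_part lookup_single when_def)

lemma part_in_homog: "part d k f \<in> homog d k"
  by (auto simp: homog_def in_keys_iff lookup_part split: if_splits)

lemma part_homog: "f \<in> homog d l \<Longrightarrow> part d k f = (if k = l then f else 0)"
  by (intro poly_mapping_eqI) (auto simp: lookup_part homog_def in_keys_iff)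

lemma sum_part:
  fixes f :: "'w \<Rightarrow>\<^sub>0 'k::comm_monoid_add"
  assumes "finite A" "d ` keys f \<subseteq> A"
  shows "(\<Sum>k\<in>A. part d k f) = f"
proof (rule poly_mapping_eqI)
  fix w
  have "lookup (\<Sum>k\<in>A. part d k f) w = (\<Sum>k\<in>A. if d w = k then lookup f w else 0)"
    by (simp add: lookup_sum lookup_part)
  also have "\<dots> = lookup f w"
    using assms by (auto simp: sum.delta in_keys_iff image_subset_iff)
  finally show "lookup (\<Sum>k\<in>A. part d k f) w = lookup f w" .
qed

lemma homog_zero [simp]: "0 \<in> homog d k"
  by (simp add: homog_def)

lemma homog_add: "f \<in> homog d k \<Longrightarrow> g \<in> homog d k \<Longrightarrow> f + g \<in> homog d k"
  for f :: "'w \<Rightarrow>\<^sub>0 'k::monoid_add"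
  using keys_add[of f g] by (auto simp: homog_def)

lemma homog_uminus: "f \<in> homog d k \<Longrightarrow> - f \<in> homog d k"
  for f :: "'w \<Rightarrow>\<^sub>0 'k::ab_group_add"
  by (auto simp: homog_def in_keys_iff)

lemma homog_diff: "f \<in> homog d k \<Longrightarrow> g \<in> homog d k \<Longrightarrow> f - g \<in> homog d k"
  for f :: "'w \<Rightarrow>\<^sub>0 'k::ab_group_add"
  by (auto simp: homog_def in_keys_iff lookup_minus)

lemma homog_sum: "(\<And>a. a \<in> A \<Longrightarrow> f a \<in> homog d k) \<Longrightarrow> sum f A \<in> homog d k"
  for f :: "'a \<Rightarrow> 'w \<Rightarrow>\<^sub>0 'k::comm_monoid_add"
  by (induction A rule: infinite_finite_induct) (simp_all add: homog_add)

lemma homog_scale: "f \<in> homog d k \<Longrightarrow> scale c f \<in> homog d k"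
  by (auto simp: homog_def in_keys_iff)

lemma homog_single: "d w = k \<Longrightarrow> single w c \<in> homog d k"
  by (simp add: homog_def)

lemma homog_mult:
  fixes f g :: "('z, 'k::ring_1) free_algebra"
  assumes "\<And>u v. d (u @ v) = d u + d v" "f \<in> homog d k" "g \<in> homog d l"
  shows "f * g \<in> homog d (k + l)"
  using keys_mult[of f g] assms by (fastforce simp: homog_def plus_list_def)

section \<open>Two-sided ideals\<close>

text \<open>Two-sided ideals of a ring that is given by a type class.\<close>

locale two_sided_ideal =
  fixes I :: "'a::ring_1 set"
  assumes zero_mem: "0 \<in> I"
    and add_mem: "f \<in> I \<Longrightarrow> g \<in> I \<Longrightarrow> f + g \<in> I"
    and lmult_mem: "f \<in> I \<Longrightarrow> g * f \<in> I"
    and rmult_mem: "f \<in> I \<Longrightarrow> f * g \<in> I"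
begin

lemma uminus_mem: "f \<in> I \<Longrightarrow> - f \<in> I"
  using lmult_mem[of f "- 1"] by simp

lemma diff_mem: "f \<in> I \<Longrightarrow> g \<in> I \<Longrightarrow> f - g \<in> I"
  using add_mem[of f "- g"] uminus_mem by simp

lemma sum_mem: "(\<And>a. a \<in> A \<Longrightarrow> f a \<in> I) \<Longrightarrow> sum f A \<in> I"
  by (induction A rule: infinite_finite_induct) (simp_all add: zero_mem add_mem)

lemma cong_trans: "f - g \<in> I \<Longrightarrow> g - h \<in> I \<Longrightarrow> f - h \<in> I"
  using add_mem[of "f - g" "g - h"] by simp

lemma cong_sym: "f - g \<in> I \<Longrightarrow> g - f \<in> I"
  using uminus_mem[of "f - g"] by simp

lemma cong_mem: "f - g \<in> I \<Longrightarrow> g \<in> I \<Longrightarrow> f \<in> I"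
  using add_mem[of "f - g" g] by simp

lemma cong_mult:
  assumes "f - f' \<in> I" "g - g' \<in> I"
  shows "f * g - f' * g' \<in> I"
proof -
  have "f * g - f' * g' = (f - f') * g + f' * (g - g')" by (simp add: algebra_simps)
  then show ?thesis using assms by (simp add: add_mem lmult_mem rmult_mem)
qed

lemma cong_add:
  assumes "f - f' \<in> I" "g - g' \<in> I"
  shows "(f + g) - (f' + g') \<in> I"
  using add_mem[OF assms] by (simp add: algebra_simps)

lemma cong_sum: "(\<And>a. a \<in> A \<Longrightarrow> f a - g a \<in> I) \<Longrightarrow> sum f A - sum g A \<in> I"
  using sum_mem[of A "\<lambda>a. f a - g a"] by (simp add: sum_subtractf)

end


section \<open>Left and right derivatives\<close>

text \<open>
  \<open>lder z\<close> strips the letter \<open>z\<close> from the left end of words and kills the words that do not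
  start with \<open>z\<close>. Likewise, \<open>rder z\<close> strips \<open>z\<close> from the right.
\<close>

definition lder :: "'z \<Rightarrow> ('z, 'k::ring_1) free_algebra \<Rightarrow> ('z, 'k) free_algebra" where
  "lder z = Poly_Mapping.map_key (\<lambda>w. z # w)"

definition rder :: "'z \<Rightarrow> ('z, 'k::ring_1) free_algebra \<Rightarrow> ('z, 'k) free_algebra" where
  "rder z = Poly_Mapping.map_key (\<lambda>w. w @ [z])"

lemma lookup_lder [simp]: "lookup (lder z f) w = lookup f (z # w)"
  by (simp add: lder_def Poly_Mapping.map_key.rep_eq inj_def)

lemma lookup_rder [simp]: "lookup (rder z f) w = lookup f (w @ [z])"
  by (simp add: rder_def Poly_Mapping.map_key.rep_eq inj_def)

lemma lder_zero [simp]: "lder z 0 = 0" and rder_zero [simp]: "rder z 0 = 0"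
  by (rule poly_mapping_eqI; simp)+

lemma lder_add: "lder z (f + g) = lder z f + lder z g"
  and rder_add: "rder z (f + g) = rder z f + rder z g"
  by (rule poly_mapping_eqI; simp add: lookup_add)+

lemma rder_diff: "rder z (f - g) = rder z f - rder z g"
  by (rule poly_mapping_eqI; simp add: lookup_minus)

lemma rder_sum: "rder z (sum f A) = (\<Sum>a\<in>A. rder z (f a))"
  by (induction A rule: infinite_finite_induct) (simp_all add: rder_add)

lemma lder_scale: "lder z (scale c f) = scale c (lder z f)"
  and rder_scale: "rder z (scale c f) = scale c (rder z f)"
  by (rule poly_mapping_eqI; simp)+

lemma lder_mon: "lder z (mon w) = (case w of [] \<Rightarrow> 0 | y # w' \<Rightarrow> if y = z then mon w' else 0)"
  by (rule poly_mapping_eqI) (auto simp: lookup_single when_def split: list.splits)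

lemma rder_Nil [simp]: "rder z (mon []) = 0"
  by (rule poly_mapping_eqI) (auto simp: lookup_single when_def)

lemma rder_snoc: "rder z (mon (w @ [y])) = (if y = z then mon w else 0)"
  by (rule poly_mapping_eqI) (auto simp: lookup_single when_def)

lemma rder_letter: "rder z (mon [y]) = (if y = z then 1 else 0)"
  using rder_snoc[of z "[]" y] by (auto simp: mon_Nil)

lemma lder_mult:
  fixes f g :: "('z, 'k::comm_ring_1) free_algebra"
  shows "lder z (f * g) = lder z f * g + scale (lookup f []) (lder z g)"
proof -
  have w: "lder z (mon u * mon v) = lder z (mon u) * (mon v :: ('z, 'k) free_algebra)
      + scale (lookup (mon u) []) (lder z (mon v))" for u v
    unfolding mon_mult by (cases u) (simp_all add: lder_mon lookup_single)
  have "lder z (mon u * g) = lder z (mon u) * g + scale (lookup (mon u) []) (lder z g)" for u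
    by (induction g rule: linear_induct)
       (simp_all only: mult_zero_right lder_zero w mult_scale lder_scale distrib_left lder_add
         scale_add scale_simps ac_simps add_0_left)
  then show ?thesis
    by (induction f rule: linear_induct)
       (simp_all add: scale_mult lder_scale distrib_right lder_add scale_add
         scale_add_left lookup_add ac_simps)
qed

lemma rder_mult:
  fixes f g :: "('z, 'k::comm_ring_1) free_algebra"
  shows "rder z (f * g) = f * rder z g + scale (lookup g []) (rder z f)"
proof -
  have w: "rder z (mon u * mon v) = mon u * (rder z (mon v) :: ('z, 'k) free_algebra)
      + scale (lookup (mon v) []) (rder z (mon u))" for u v
  proof (cases v rule: rev_cases)
    case (snoc w y)
    have "rder z (mon (u @ w @ [y])) = (if y = z then mon (u @ w) else 0 :: ('z, 'k) free_algebra)"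
      using rder_snoc[of z "u @ w" y] by simp
    then show ?thesis using snoc by (simp add: rder_snoc lookup_single)
  qed simp
  have "rder z (mon u * g) = mon u * rder z g + scale (lookup g []) (rder z (mon u))" for u
    by (induction g rule: linear_induct)
       (simp_all only: mult_zero_right rder_zero w mult_scale rder_scale distrib_left rder_add
         scale_add scale_add_left lookup_add lookup_scale lookup_zero scale_simps ac_simps add_0_left)
  then show ?thesis
    by (induction f rule: linear_induct)
       (simp_all add: scale_mult rder_scale distrib_right rder_add scale_add
         scale_add_left lookup_add ac_simps)
qed

lemma sum_rder_mult:
  fixes f :: "('z, 'k::comm_ring_1) free_algebra"
  assumes "finite Z" "\<And>w. w \<in> keys f \<Longrightarrow> w \<noteq> [] \<and> last w \<in> Z"
  shows "f = (\<Sum>z\<in>Z. rder z f * mon [z])"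
proof (rule poly_mapping_eqI)
  fix w
  have r: "lookup (g * mon [z]) w = (if w \<noteq> [] \<and> last w = z then lookup g (butlast w) else 0)"
    for g :: "('z, 'k) free_algebra" and z
  proof (induction g rule: linear_induct)
    case (mon v)
    have "v @ [z] = w \<longleftrightarrow> w \<noteq> [] \<and> last w = z \<and> v = butlast w" by auto
    then show ?case by (auto simp: lookup_single when_def)
  qed (simp_all add: scale_mult distrib_right lookup_add)
  have "lookup (\<Sum>z\<in>Z. rder z f * mon [z]) w =
      (\<Sum>z\<in>Z. if w \<noteq> [] \<and> last w = z then lookup f (butlast w @ [z]) else 0)"
    by (simp add: lookup_sum r cong: if_cong)
  also have "\<dots> = lookup f w"
  proof (cases "w = [] \<or> last w \<notin> Z")
    case True
    then have "w \<notin> keys f" using assms(2) by blast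
    then show ?thesis using True by (auto simp: in_keys_iff intro!: sum.neutral)
  next
    case False
    then show ?thesis using assms(1)
      by (subst sum.remove[of Z "last w"]) (auto intro!: sum.neutral)
  qed
  finally show "lookup f w = lookup (\<Sum>z\<in>Z. rder z f * mon [z]) w" by simp
qed

lemma rder_homog_length: "f \<in> homog length (Suc k) \<Longrightarrow> rder z f \<in> homog length k"
  by (force simp: homog_def in_keys_iff)

section \<open>The homogeneous ideal\<close>

text \<open>
  \<open>Lx i r\<close> and \<open>Ly r j\<close> stand for \<open>x\<^sub>i\<^sub>r\<close> and \<open>y\<^sub>r\<^sub>j\<close>, and \<open>Lu i\<close> and \<open>Lv i\<close> for \<open>u\<^sub>i\<close> and \<open>v\<^sub>i\<close>. The
  indices are arbitrary natural numbers, so that the type does not depend on \<open>n\<close>. The letters whose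
  indices are too large for the matrices \<open>X\<close> and \<open>Y\<close> play no role.
\<close>

datatype letter = Lx nat nat | Ly nat nat | Lu nat | Lv nat

text \<open>The entries of \<open>X Y\<close>, where the rows of \<open>X\<close> and the columns of \<open>Y\<close> are numbered by \<open>0, \<dots>, n\<close>.\<close>

definition q :: "nat \<Rightarrow> nat \<Rightarrow> nat \<Rightarrow> (letter, 'k::field) free_algebra" where
  "q n i j = (\<Sum>r<n. mon [Lx i r, Ly r j])"

text \<open>The two-sided ideal generated by the entries of \<open>X Y\<close>.\<close>

inductive_set I0 :: "nat \<Rightarrow> (letter, 'k::field) free_algebra set" for n where
  zero: "0 \<in> I0 n"
| add: "f \<in> I0 n \<Longrightarrow> g \<in> I0 n \<Longrightarrow> f + g \<in> I0 n"
| gen: "i \<le> n \<Longrightarrow> j \<le> n \<Longrightarrow> scale c (mon u * q n i j * mon v) \<in> I0 n"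

lemma I0_scale: "f \<in> I0 n \<Longrightarrow> scale c f \<in> I0 n"
proof (induction rule: I0.induct)
  case (gen i j d u v)
  then show ?case using I0.gen[of i n j "c * d" u v] by simp
qed (simp_all add: scale_add I0.zero I0.add)

interpretation I0: two_sided_ideal "I0 n"
proof
  show "0 \<in> I0 n" by (rule I0.zero)
  show "f + g \<in> I0 n" if "f \<in> I0 n" "g \<in> I0 n" for f g :: "(letter, 'k::field) free_algebra"
    using that by (rule I0.add)
  fix f g :: "(letter, 'k::field) free_algebra"
  assume f: "f \<in> I0 n"
  have l: "mon w * f \<in> I0 n" for w
    using f
  proof (induction rule: I0.induct)
    case (gen i j c u v)
    then show ?case using I0.gen[of i n j c "w @ u" v]
      by (simp add: mult_scale flip: mult.assoc)
  qed (simp_all add: distrib_left I0.zero I0.add)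
  have r: "f * mon w \<in> I0 n" for w
    using f
  proof (induction rule: I0.induct)
    case (gen i j c u v)
    then show ?case using I0.gen[of i n j c u "v @ w"]
      by (simp add: scale_mult mult.assoc)
  qed (simp_all add: distrib_right I0.zero I0.add)
  show "g * f \<in> I0 n"
    by (induction g rule: linear_induct)
       (simp_all add: l scale_mult I0_scale distrib_right I0.zero I0.add)
  show "f * g \<in> I0 n"
    by (induction g rule: linear_induct)
       (simp_all add: r mult_scale I0_scale distrib_left I0.zero I0.add)
qed

lemma q_in_I0: "i \<le> n \<Longrightarrow> j \<le> n \<Longrightarrow> q n i j \<in> I0 n"
  using I0.gen[of i n j 1 "[]" "[]"] by (simp add: mon_Nil)

lemma q_homog: "q n i j \<in> homog length 2"
  unfolding q_def by (intro homog_sum homog_single) simp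

lemma length_append_plus: "length (u @ v) = length u + length v"
  by simp

lemmas homog_length_mult = homog_mult[where d = length, OF length_append_plus]

lemma I0_gen_homog:
  "scale c (mon u * q n i j * mon v) \<in> homog length (length u + 2 + length v)"
  by (intro homog_scale homog_length_mult q_homog homog_single) simp_all

lemma I0_part: "f \<in> I0 n \<Longrightarrow> part length k f \<in> I0 n"
proof (induction rule: I0.induct)
  case (gen i j c u v)
  then show ?case
    unfolding part_homog[OF I0_gen_homog] by (auto intro: I0.zero I0.gen)
qed (simp_all add: part_add I0.zero I0.add)

lemma lookup_q_Nil [simp]: "lookup (q n i j) [] = 0"
  by (simp add: q_def lookup_sum lookup_single)

lemma lder_q: "lder (Ly r j) (q n i l) = 0"
  by (rule poly_mapping_eqI) (simp add: q_def lookup_sum lookup_single)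

lemma lookup_mult_Nil: "lookup (f * g) [] = lookup f [] * lookup g []"
  for f g :: "('z, 'k::comm_ring_1) free_algebra"
proof -
  have "lookup (mon u * g) [] = lookup (mon u) [] * lookup g []" for u
    by (induction g rule: linear_induct)
       (simp_all add: mult_scale distrib_left lookup_add lookup_single when_def)
  then show ?thesis
    by (induction f rule: linear_induct)
       (simp_all add: scale_mult distrib_right lookup_add distrib_right mult.assoc)
qed

lemma lder_I0: "f \<in> I0 n \<Longrightarrow> lder (Ly r j) f \<in> I0 n"
  for f :: "(letter, 'k::field) free_algebra"
proof (induction rule: I0.induct)
  case (gen i l c u v)
  have "lder (Ly r j) (mon u * q n i l * mon v) = lder (Ly r j) (mon u) * (q n i l * mon v :: (letter, 'k) free_algebra)"
    by (simp add: lder_mult lder_q lookup_mult_Nil mult.assoc)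
  then show ?case using gen
    by (simp add: lder_scale I0_scale I0.lmult_mem I0.rmult_mem q_in_I0)
qed (simp_all add: lder_add I0.zero I0.add)

lemma lookup_I0_Nil: "f \<in> I0 n \<Longrightarrow> lookup f [] = 0"
  by (induction rule: I0.induct) (simp_all add: lookup_add lookup_mult_Nil)

text \<open>
  As a left ideal, \<open>I0 n\<close> is generated by the products \<open>f z\<close> with \<open>f \<in> I0 n\<close> and a letter \<open>z\<close>, and by
  the entries of \<open>X Y\<close>. The next two lemmas are the resulting conditions on the right derivatives
  of an element: for the letter \<open>y\<^sub>r\<^sub>j\<close>, the derivative belongs to \<open>I0 n\<close> up to a left linear
  combination of the entries in the column \<open>r\<close> of \<open>X\<close>, whose coefficients do not depend on \<open>r\<close>.
\<close>

lemma rder_I0: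
  fixes f :: "(letter, 'k::field) free_algebra"
  assumes "f \<in> I0 n" "\<And>r j. r < n \<Longrightarrow> j \<le> n \<Longrightarrow> z \<noteq> Ly r j"
  shows "rder z f \<in> I0 n"
  using assms(1)
proof (induction rule: I0.induct)
  case (gen i j c u v)
  have "rder z (q n i j) = (0 :: (letter, 'k) free_algebra)"
  proof -
    have "rder z (mon [Lx i r, Ly r j]) = (0 :: (letter, 'k) free_algebra)" if "r < n" for r
      using rder_snoc[of z "[Lx i r]" "Ly r j"] assms(2)[OF that gen(2)] by auto
    then show ?thesis by (simp add: q_def rder_sum)
  qed
  then have "rder z (mon u * q n i j * mon v) = (mon u * q n i j * rder z (mon v) :: (letter, 'k) free_algebra)"
    by (simp add: rder_mult)
  then show ?case using gen
    by (simp add: rder_scale I0_scale I0.lmult_mem I0.rmult_mem q_in_I0)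
qed (simp_all add: rder_add I0.zero I0.add)

lemma rder_Y_I0:
  fixes f :: "(letter, 'k::field) free_algebra"
  assumes "f \<in> I0 n" "j \<le> n"
  shows "\<exists>e. \<forall>r<n. rder (Ly r j) f - (\<Sum>i\<le>n. e i * mon [Lx i r]) \<in> I0 n"
  using assms(1)
proof (induction rule: I0.induct)
  case zero
  show ?case by (intro exI[of _ "\<lambda>_. 0"]) (simp add: I0.zero)
next
  case (add f g)
  then obtain e e' where
    "\<forall>r<n. rder (Ly r j) f - (\<Sum>i\<le>n. e i * mon [Lx i r]) \<in> I0 n"
    "\<forall>r<n. rder (Ly r j) g - (\<Sum>i\<le>n. e' i * mon [Lx i r]) \<in> I0 n" by blast
  then show ?case
    by (intro exI[of _ "\<lambda>i. e i + e' i"])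
       (auto simp: rder_add distrib_right sum.distrib intro!: I0.cong_add)
next
  case (gen a b c u v)
  define e :: "nat \<Rightarrow> (letter, 'k) free_algebra"
    where "e i = (if i = a \<and> b = j then scale (c * lookup (mon v) []) (mon u) else 0)" for i
  have "rder (Ly r j) (scale c (mon u * q n a b * mon v)) - (\<Sum>i\<le>n. e i * mon [Lx i r]) \<in> I0 n"
    if r: "r < n" for r
  proof -
    have "rder (Ly r j) (mon [Lx a s, Ly s b]) =
        (if s = r then if b = j then mon [Lx a r] else 0 else 0 :: (letter, 'k) free_algebra)" for s
      using rder_snoc[of "Ly r j" "[Lx a s]" "Ly s b"] by auto
    then have "rder (Ly r j) (q n a b) = (if b = j then mon [Lx a r] else 0 :: (letter, 'k) free_algebra)"
      using r by (simp add: q_def rder_sum)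
    moreover have "(\<Sum>i\<le>n. e i * mon [Lx i r]) = e a * mon [Lx a r]"
      using gen(1) by (subst sum.remove[of _ a]) (auto simp: e_def intro!: sum.neutral)
    ultimately have "rder (Ly r j) (scale c (mon u * q n a b * mon v)) - (\<Sum>i\<le>n. e i * mon [Lx i r]) =
        scale c (mon u * q n a b * rder (Ly r j) (mon v))"
      by (simp add: rder_scale rder_mult scale_add e_def scale_mult)
    then show ?thesis using gen
      by (simp add: I0_scale I0.lmult_mem I0.rmult_mem q_in_I0)
  qed
  then show ?case by blast
qed

section \<open>The graded weak algorithm\<close>

text \<open>
  If fewer than \<open>n\<close> elements satisfy a nontrivial relation modulo \<open>I0 n\<close> with homogeneous
  coefficients on the right, then one of them is a right linear combination of the others modulo
  \<open>I0 n\<close>. The proof strips letters from the right ends of the coefficients until one of them is a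
  nonzero scalar. The bound on the number of elements is needed for stripping the letters \<open>y\<^sub>r\<^sub>j\<close>.
\<close>

lemma graded_weak_algorithm:
  fixes A B :: "'i \<Rightarrow> (letter, 'k::field) free_algebra"
  assumes "finite T" "card T < n" "T \<noteq> {}"
    and "\<And>l. l \<in> T \<Longrightarrow> B l \<in> homog length (\<beta> l)" "\<And>l. l \<in> T \<Longrightarrow> B l \<notin> I0 n"
    and "(\<Sum>l\<in>T. A l * B l) \<in> I0 n"
  shows "\<exists>m\<in>T. \<exists>C. A m - (\<Sum>l\<in>T - {m}. A l * C l) \<in> I0 n"
  using assms
proof (induction "\<Sum>l\<in>T. \<beta> l" arbitrary: T B \<beta> rule: less_induct)
  case less
  note T = less.prems(1-3) and B = less.prems(4) and BI = less.prems(5) and AB = less.prems(6)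
  \<comment> \<open>It suffices to find another nontrivial relation in which the degree of each coefficient has
    dropped by one.\<close>
  have descend: ?case
    if \<beta>: "\<And>l. l \<in> T \<Longrightarrow> \<beta> l \<noteq> 0" and m: "m \<in> T" "B' m \<notin> I0 n"
      and B': "\<And>l. l \<in> T \<Longrightarrow> B' l \<in> homog length (\<beta> l - 1)" "(\<Sum>l\<in>T. A l * B' l) \<in> I0 n"
    for B' m
  proof -
    define T' where "T' = {l \<in> T. B' l \<notin> I0 n}"
    have sub: "T' \<subseteq> T" and T': "finite T'" "T' \<noteq> {}" using T m by (auto simp: T'_def)
    have "(\<Sum>l\<in>T'. \<beta> l - 1) < (\<Sum>l\<in>T'. \<beta> l)"
      using T' sub \<beta> by (intro sum_strict_mono) auto
    also have "\<dots> \<le> (\<Sum>l\<in>T. \<beta> l)" using sub T by (intro sum_mono2) auto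
    finally have less': "(\<Sum>l\<in>T'. \<beta> l - 1) < (\<Sum>l\<in>T. \<beta> l)" .
    have card: "card T' < n" using card_mono[OF T(1) sub] T(2) by simp
    have "(\<Sum>l\<in>T. A l * B' l) = (\<Sum>l\<in>T - T'. A l * B' l) + (\<Sum>l\<in>T'. A l * B' l)"
      by (rule sum.subset_diff[OF sub T(1)])
    then have eq: "(\<Sum>l\<in>T'. A l * B' l) = (\<Sum>l\<in>T. A l * B' l) - (\<Sum>l\<in>T - T'. A l * B' l)"
      by simp
    have "(\<Sum>l\<in>T - T'. A l * B' l) \<in> I0 n"
      by (intro I0.sum_mem I0.lmult_mem) (auto simp: T'_def)
    then have "(\<Sum>l\<in>T'. A l * B' l) \<in> I0 n"
      unfolding eq by (rule I0.diff_mem[OF B'(2)])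
    then have "\<exists>m\<in>T'. \<exists>C. A m - (\<Sum>l\<in>T' - {m}. A l * C l) \<in> I0 n"
      using B'(1) by (intro less.hyps[OF less' T'(1) card T'(2)]) (auto simp: T'_def)
    then obtain m C where mC: "m \<in> T'" "A m - (\<Sum>l\<in>T' - {m}. A l * C l) \<in> I0 n"
      by blast
    have "(\<Sum>l\<in>T - {m}. A l * (if l \<in> T' then C l else 0)) = (\<Sum>l\<in>T' - {m}. A l * C l)"
      using sub T(1) by (intro sum.mono_neutral_cong_right) auto
    then show ?thesis using mC sub
      by (intro bexI[of _ m] exI[of _ "\<lambda>l. if l \<in> T' then C l else 0"]) auto
  qed
  show ?case
  proof (cases "\<exists>m\<in>T. \<beta> m = 0")
    case True
    then obtain m where m: "m \<in> T" "\<beta> m = 0" by blast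
    define c where "c = lookup (B m) []"
    have Bm: "B m = scale c 1"
      using B[OF m(1)] m(2)
      by (intro poly_mapping_eqI)
         (auto simp: c_def lookup_homog lookup_one zero_list_def when_def)
    with BI[OF m(1)] have c: "c \<noteq> 0" by (auto simp: I0.zero)
    have "(\<Sum>l\<in>T. A l * B l) = A m * B m + (\<Sum>l\<in>T - {m}. A l * B l)"
      using m T by (simp add: sum.remove)
    then have "scale (inverse c) (\<Sum>l\<in>T. A l * B l) = A m - (\<Sum>l\<in>T - {m}. A l * scale (- inverse c) (B l))"
      using c by (simp add: Bm mult_scale scale_add scale_sum scale_uminus sum_negf)
    then show ?thesis using I0_scale[OF AB, of "inverse c"] m by auto
  next
    case False
    then have \<beta>: "\<beta> l \<noteq> 0" if "l \<in> T" for l using that by simp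
    have Bnil: "lookup (B l) [] = 0" if "l \<in> T" for l
      using lookup_homog[OF B[OF that], of "[]"] \<beta>[OF that] by simp
    have rB: "rder z (B l) \<in> homog length (\<beta> l - 1)" if "l \<in> T" for l z
      using B[OF that] \<beta>[OF that] rder_homog_length[of "B l" "\<beta> l - 1"] by simp
    have rAB: "rder z (\<Sum>l\<in>T. A l * B l) = (\<Sum>l\<in>T. A l * rder z (B l))" for z
      by (simp add: rder_sum rder_mult Bnil)
    show ?thesis
    proof (cases "\<exists>z. \<exists>m\<in>T. (\<forall>r<n. \<forall>j\<le>n. z \<noteq> Ly r j) \<and> rder z (B m) \<notin> I0 n")
      case True
      then obtain z m where z: "m \<in> T" "rder z (B m) \<notin> I0 n" "\<And>r j. r < n \<Longrightarrow> j \<le> n \<Longrightarrow> z \<noteq> Ly r j"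
        by blast
      show ?thesis
        using descend[OF \<beta> z(1,2) rB] rder_I0[OF AB z(3)] unfolding rAB by blast
    next
      case False
      then have free: "rder z (B l) \<in> I0 n"
        if "l \<in> T" "\<And>r j. r < n \<Longrightarrow> j \<le> n \<Longrightarrow> z \<noteq> Ly r j" for z l using that by blast
      define Q where "Q j E \<longleftrightarrow> (\<forall>l\<in>T. \<forall>i r. E i l * mon [Lx i r] \<in> homog length (\<beta> l - 1)) \<and>
          (\<forall>r<n. (\<Sum>l\<in>T. A l * (rder (Ly r j) (B l) - (\<Sum>i\<le>n. E i l * mon [Lx i r]))) \<in> I0 n)" for j E
      have "\<exists>E. Q j E" if j: "j \<le> n" for j
      proof -
        obtain e where e: "\<And>r. r < n \<Longrightarrow>
            (\<Sum>l\<in>T. A l * rder (Ly r j) (B l)) - (\<Sum>i\<le>n. e i * mon [Lx i r]) \<in> I0 n"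
          using rder_Y_I0[OF AB j] unfolding rAB by blast
        \<comment> \<open>Since \<open>T\<close> has fewer than \<open>n\<close> elements, a nontrivial linear combination of these \<open>n\<close> relations
          has coefficients \<open>B' l\<close> without constant terms. Stripping \<open>x\<^sub>i\<^sub>s\<close> from it expresses \<open>e i\<close> as a
          right linear combination of the \<open>A l\<close>.\<close>
        obtain g s where g: "s < n" "g s \<noteq> 0"
            "\<And>l. l \<in> T \<Longrightarrow> (\<Sum>r<n. g r * lookup (rder (Ly r j) (B l)) []) = 0"
          using exists_linear_dependence[of T "{..<n}" "\<lambda>l r. lookup (rder (Ly r j) (B l)) []"] T
          by auto
        define B' where "B' l = (\<Sum>r<n. scale (g r) (rder (Ly r j) (B l)))" for l
        define E where "E i l = scale (inverse (g s)) (rder (Lx i s) (B' l))" for i l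
        have B'nil: "lookup (B' l) [] = 0" if "l \<in> T" for l
          using g(3)[OF that] by (simp add: B'_def lookup_sum)
        have B'h: "B' l \<in> homog length (\<beta> l - 1)" if "l \<in> T" for l
          unfolding B'_def by (intro homog_sum homog_scale rB that)
        have Eh: "E i l * mon [Lx i r] \<in> homog length (\<beta> l - 1)" if l: "l \<in> T" for i l r
        proof (cases "\<beta> l - 1")
          case 0
          then have "rder (Lx i s) (B' l) = 0"
            using B'h[OF l] by (intro poly_mapping_eqI) (simp add: lookup_homog)
          then show ?thesis by (simp add: E_def)
        next
          case (Suc k)
          have "E i l \<in> homog length k"
            unfolding E_def using B'h[OF l] Suc by (intro homog_scale rder_homog_length) simp
          from homog_length_mult[OF this homog_single, of "[Lx i r]" 1 1] show ?thesis
            using Suc by simp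
        qed
        have e_cong: "(\<Sum>l\<in>T. A l * E i l) - e i \<in> I0 n" if i: "i \<le> n" for i
        proof -
          define D where "D = (\<Sum>r<n. scale (g r)
            ((\<Sum>l\<in>T. A l * rder (Ly r j) (B l)) - (\<Sum>i\<le>n. e i * mon [Lx i r])))"
          have "D \<in> I0 n" unfolding D_def using e by (intro I0.sum_mem I0_scale) auto
          then have "scale (inverse (g s)) (rder (Lx i s) D) \<in> I0 n"
            by (intro I0_scale rder_I0) auto
          moreover have "D = (\<Sum>l\<in>T. A l * B' l) - (\<Sum>r<n. \<Sum>i\<le>n. scale (g r) (e i * mon [Lx i r]))"
          proof -
            have "(\<Sum>r<n. scale (g r) (\<Sum>l\<in>T. A l * rder (Ly r j) (B l))) = (\<Sum>l\<in>T. A l * B' l)"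
              unfolding scale_sum by (subst sum.swap) (simp add: B'_def sum_distrib_left mult_scale)
            then show ?thesis by (simp add: D_def scale_diff sum_subtractf scale_sum)
          qed
          moreover have "rder (Lx i s) (\<Sum>l\<in>T. A l * B' l) = (\<Sum>l\<in>T. A l * rder (Lx i s) (B' l))"
            by (simp add: rder_sum rder_mult B'nil)
          moreover have "rder (Lx i s) (\<Sum>r<n. \<Sum>i\<le>n. scale (g r) (e i * mon [Lx i r])) = scale (g s) (e i)"
          proof -
            have "rder (Lx i s) (scale (g r) (e a * mon [Lx a r])) =
                (if a = i then if r = s then scale (g s) (e i) else 0 else 0)" for a r
              by (auto simp: rder_scale rder_mult rder_letter lookup_single)
            then show ?thesis using i g(1) by (simp add: rder_sum)
          qed
          ultimately have "scale (inverse (g s))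
              ((\<Sum>l\<in>T. A l * rder (Lx i s) (B' l)) - scale (g s) (e i)) \<in> I0 n"
            by (simp add: rder_diff)
          then show ?thesis using g(2)
            by (simp add: E_def scale_diff scale_sum mult_scale)
        qed
        have "(\<Sum>l\<in>T. A l * (rder (Ly r j) (B l) - (\<Sum>i\<le>n. E i l * mon [Lx i r]))) \<in> I0 n"
          if r: "r < n" for r
        proof -
          have "(\<Sum>l\<in>T. A l * (rder (Ly r j) (B l) - (\<Sum>i\<le>n. E i l * mon [Lx i r]))) =
              (\<Sum>l\<in>T. A l * rder (Ly r j) (B l)) - (\<Sum>l\<in>T. \<Sum>i\<le>n. A l * E i l * mon [Lx i r])"
            by (simp add: right_diff_distrib sum_subtractf sum_distrib_left mult.assoc)
          also have "(\<Sum>l\<in>T. \<Sum>i\<le>n. A l * E i l * mon [Lx i r]) =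
              (\<Sum>i\<le>n. (\<Sum>l\<in>T. A l * E i l) * mon [Lx i r])"
            by (subst sum.swap) (simp add: sum_distrib_right)
          finally have eq: "(\<Sum>l\<in>T. A l * (rder (Ly r j) (B l) - (\<Sum>i\<le>n. E i l * mon [Lx i r]))) =
              ((\<Sum>l\<in>T. A l * rder (Ly r j) (B l)) - (\<Sum>i\<le>n. e i * mon [Lx i r])) -
              (\<Sum>i\<le>n. ((\<Sum>l\<in>T. A l * E i l) - e i) * mon [Lx i r])"
            by (simp add: left_diff_distrib sum_subtractf)
          show ?thesis unfolding eq
            by (rule I0.diff_mem[OF e[OF r]], rule I0.sum_mem, rule I0.rmult_mem, rule e_cong) simp
        qed
        then have "Q j E" unfolding Q_def using Eh by simp
        then show ?thesis by blast
      qed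
      then have "\<forall>j. \<exists>E. j \<le> n \<longrightarrow> Q j E" by blast
      from choice[OF this] obtain E where E: "\<And>j. j \<le> n \<Longrightarrow> Q j (E j)" by blast
      have Eh: "E j i l * mon [Lx i r] \<in> homog length (\<beta> l - 1)" if "j \<le> n" "l \<in> T" for j l i r
        using E[OF that(1)] that(2) by (simp add: Q_def)
      have EI: "(\<Sum>l\<in>T. A l * (rder (Ly r j) (B l) - (\<Sum>i\<le>n. E j i l * mon [Lx i r]))) \<in> I0 n"
        if "j \<le> n" "r < n" for j r
        using E[OF that(1)] that(2) by (simp add: Q_def)
      define B' where "B' r j l = rder (Ly r j) (B l) - (\<Sum>i\<le>n. E j i l * mon [Lx i r])" for r j l
      have B'h: "B' r j l \<in> homog length (\<beta> l - 1)" if "j \<le> n" "l \<in> T" for r j l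
        unfolding B'_def using that by (intro homog_diff homog_sum rB Eh) auto
      \<comment> \<open>If all these coefficients vanished modulo \<open>I0 n\<close>, then so would the \<open>B l\<close>, because the
        corrections to the derivatives by the \<open>y\<^sub>r\<^sub>j\<close> add up to multiples of the entries of \<open>X Y\<close>.\<close>
      have "\<exists>r j m. r < n \<and> j \<le> n \<and> m \<in> T \<and> B' r j m \<notin> I0 n"
      proof (rule ccontr)
        assume "\<not> ?thesis"
        then have B'I: "B' r j l \<in> I0 n" if "r < n" "j \<le> n" "l \<in> T" for r j l using that by blast
        obtain l where l: "l \<in> T" using T(3) by blast
        define P where "P = {..<n} \<times> {..n}"
        define W where "W = (\<lambda>(r, j). Ly r j) ` P"
        define Z where "Z = last ` keys (B l) \<union> W"
        have fin: "finite P" "finite Z" "W \<subseteq> Z" by (auto simp: P_def W_def Z_def)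
        have "B l = (\<Sum>z\<in>Z. rder z (B l) * mon [z])"
          using Bnil[OF l] by (intro sum_rder_mult fin) (auto simp: Z_def in_keys_iff)
        also have "\<dots> = (\<Sum>z\<in>W. rder z (B l) * mon [z]) + (\<Sum>z\<in>Z - W. rder z (B l) * mon [z])"
          using sum.subset_diff[OF fin(3,2)] by (simp add: add.commute)
        also have "(\<Sum>z\<in>W. rder z (B l) * mon [z]) = (\<Sum>(r, j)\<in>P. rder (Ly r j) (B l) * mon [Ly r j])"
          unfolding W_def by (subst sum.reindex) (auto simp: inj_on_def case_prod_unfold)
        also have "\<dots> = (\<Sum>(r, j)\<in>P. B' r j l * mon [Ly r j]) +
            (\<Sum>(r, j)\<in>P. \<Sum>i\<le>n. E j i l * mon [Lx i r, Ly r j])"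
          unfolding sum.distrib[symmetric]
          by (intro sum.cong) (auto simp: B'_def left_diff_distrib sum_distrib_right mult.assoc)
        also have "(\<Sum>(r, j)\<in>P. \<Sum>i\<le>n. E j i l * mon [Lx i r, Ly r j]) =
            (\<Sum>j\<le>n. \<Sum>i\<le>n. E j i l * q n i j)"
        proof -
          have "(\<Sum>(r, j)\<in>P. \<Sum>i\<le>n. E j i l * mon [Lx i r, Ly r j]) =
              (\<Sum>j\<le>n. \<Sum>r<n. \<Sum>i\<le>n. E j i l * mon [Lx i r, Ly r j])"
            unfolding P_def by (subst sum.cartesian_product[symmetric]) (rule sum.swap)
          also have "\<dots> = (\<Sum>j\<le>n. \<Sum>i\<le>n. \<Sum>r<n. E j i l * mon [Lx i r, Ly r j])"
            by (intro sum.cong refl sum.swap)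
          finally show ?thesis by (simp add: q_def sum_distrib_left)
        qed
        finally have Bl: "B l = (\<Sum>(r, j)\<in>P. B' r j l * mon [Ly r j]) +
            (\<Sum>j\<le>n. \<Sum>i\<le>n. E j i l * q n i j) + (\<Sum>z\<in>Z - W. rder z (B l) * mon [z])" .
        have "(\<Sum>(r, j)\<in>P. B' r j l * mon [Ly r j]) \<in> I0 n"
          using B'I l by (intro I0.sum_mem) (auto simp: P_def intro!: I0.rmult_mem)
        moreover have "(\<Sum>j\<le>n. \<Sum>i\<le>n. E j i l * q n i j) \<in> I0 n"
          by (intro I0.sum_mem I0.lmult_mem q_in_I0) auto
        moreover have "(\<Sum>z\<in>Z - W. rder z (B l) * mon [z]) \<in> I0 n"
          by (intro I0.sum_mem I0.rmult_mem free[OF l]) (auto simp: W_def P_def)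
        ultimately have "B l \<in> I0 n" by (subst Bl) (intro I0.add_mem)
        then show False using BI[OF l] by simp
      qed
      then obtain r j m where m: "r < n" "j \<le> n" "m \<in> T" "B' r j m \<notin> I0 n" by blast
      show ?thesis
      proof (rule descend[OF \<beta> m(3), of "B' r j"])
        show "B' r j m \<notin> I0 n" by fact
        show "B' r j l \<in> homog length (\<beta> l - 1)" if "l \<in> T" for l using B'h m that by blast
        show "(\<Sum>l\<in>T. A l * B' r j l) \<in> I0 n" using EI[OF m(2,1)] by (simp add: B'_def)
      qed
    qed
  qed
qed

section \<open>The inhomogeneous ideal\<close>

text \<open>
  A deformation of the left multiplication by letters: \<open>x\<^sub>i\<^sub>0\<close> acts as the sum of the left multiplication
  and of the contraction that cancels a leading letter \<open>y\<^sub>0\<^sub>i\<close>. All other letters act by left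
  multiplication.
\<close>

definition contr :: "letter \<Rightarrow> (letter, 'k::field) free_algebra \<Rightarrow> (letter, 'k) free_algebra" where
  "contr z f = (case z of Lx i r \<Rightarrow> if r = 0 then lder (Ly 0 i) f else 0 | _ \<Rightarrow> 0)"

definition phi :: "letter \<Rightarrow> letter list \<Rightarrow> (letter, 'k::field) free_algebra" where
  "phi z w = mon (z # w) + contr z (mon w)"

lemma contr_zero [simp]: "contr z 0 = 0"
  and contr_add: "contr z (f + g) = contr z f + contr z g"
  and contr_scale: "contr z (scale c f) = scale c (contr z f)"
  by (simp_all add: contr_def lder_add lder_scale split: letter.split)

lemma lin_phi: "lin (phi z) f = mon [z] * f + contr z f"
  by (induction f rule: linear_induct)
     (simp_all add: phi_def lin_scale lin_add contr_add contr_scale scale_add mult_scale distrib_left)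

lemma act_phi_I0:
  assumes "f \<in> I0 n"
  shows "act phi g f \<in> I0 n"
proof -
  have "act phi (mon w) f \<in> I0 n" for w
    by (induction w)
       (use assms in \<open>auto simp: act_Cons lin_phi contr_def I0.lmult_mem I0.zero I0.add lder_I0
          split: letter.split\<close>)
  then show ?thesis
    by (induction g rule: linear_induct)
       (simp_all add: act_scale_left act_add_left I0.zero I0.add I0_scale)
qed

text \<open>The entry of \<open>X Y - 1\<close> acts as the left multiplication by the entry of \<open>X Y\<close>.\<close>

lemma act_phi_q:
  assumes "n > 0"
  shows "act phi (q n i j) f = q n i j * f + (if i = j then f else 0)"
proof -
  have "act phi (mon [Lx i r, Ly r j]) f =
      mon [Lx i r, Ly r j] * f + (if r = 0 then if i = j then f else 0 else 0)" for r
    using assms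
    by (auto simp: act_Cons lin_phi contr_def lder_mult lder_mon lookup_single mon_Nil
        simp flip: mult.assoc)
  then show ?thesis using assms
    by (simp add: q_def act_sum_left sum_distrib_right sum.distrib)
qed

text \<open>
  The annihilator of the quotient of the free algebra by \<open>I0 n\<close>, with respect to the deformed action.
\<close>

definition I1 :: "nat \<Rightarrow> (letter, 'k::field) free_algebra set" where
  "I1 n = {g. \<forall>f. act phi g f \<in> I0 n}"

interpretation I1: two_sided_ideal "I1 n"
  by standard (auto simp: I1_def act_add_left act_mult I0.zero I0.add act_phi_I0)

lemma q_cong_I1:
  assumes "n > 0" "i \<le> n" "j \<le> n"
  shows "q n i j - (if i = j then 1 else 0) \<in> I1 n"
  using assms q_in_I0[OF assms(2,3)]
  by (auto simp: I1_def act_diff_left act_phi_q intro: I0.rmult_mem)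

lemma I1_scale: "f \<in> I1 n \<Longrightarrow> scale c f \<in> I1 n"
  by (simp add: scale_eq_mult I1.lmult_mem)

section \<open>The filtration by length\<close>

text \<open>The linear combinations of words of length less than \<open>d\<close>.\<close>

definition short :: "nat \<Rightarrow> ('z, 'k::zero) free_algebra set" where
  "short d = {f. \<forall>w\<in>keys f. length w < d}"

lemma short_iff: "f \<in> short d \<longleftrightarrow> (\<forall>w. d \<le> length w \<longrightarrow> lookup f w = 0)"
  by (auto simp: short_def in_keys_iff not_le[symmetric])

lemma short_zero [simp]: "0 \<in> short d"
  by (simp add: short_iff)

lemma short_0_iff: "f \<in> short 0 \<longleftrightarrow> f = 0"
  by (auto simp: short_iff intro: poly_mapping_eqI)

lemma short_add: "f \<in> short d \<Longrightarrow> g \<in> short d \<Longrightarrow> f + g \<in> short d"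
  for f :: "('z, 'k::monoid_add) free_algebra"
  by (simp add: short_iff lookup_add)

lemma short_diff: "f \<in> short d \<Longrightarrow> g \<in> short d \<Longrightarrow> f - g \<in> short d"
  for f :: "('z, 'k::ab_group_add) free_algebra"
  by (simp add: short_iff lookup_minus)

lemma short_scale: "f \<in> short d \<Longrightarrow> scale c f \<in> short d"
  by (simp add: short_iff)

lemma short_sum: "(\<And>a. a \<in> A \<Longrightarrow> f a \<in> short d) \<Longrightarrow> sum f A \<in> short d"
  for f :: "'a \<Rightarrow> ('z, 'k::comm_monoid_add) free_algebra"
  by (induction A rule: infinite_finite_induct) (simp_all add: short_add)

lemma short_mono: "f \<in> short d \<Longrightarrow> d \<le> d' \<Longrightarrow> f \<in> short d'"
  by (auto simp: short_def)

lemma homog_imp_short: "f \<in> homog length d \<Longrightarrow> d < d' \<Longrightarrow> f \<in> short d'"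
  by (auto simp: short_def homog_def)

lemma short_mult:
  fixes f g :: "('z, 'k::ring_1) free_algebra"
  assumes "f \<in> short a" "g \<in> short (Suc b)"
  shows "f * g \<in> short (a + b)" "g * f \<in> short (b + a)"
  using keys_mult[of f g] keys_mult[of g f] assms
  by (fastforce simp: short_def plus_list_def)+

lemma short_diff_part: "f \<in> short (Suc d) \<Longrightarrow> f - part length d f \<in> short d"
  for f :: "('z, 'k::ab_group_add) free_algebra"
  by (auto simp: short_iff lookup_minus lookup_part)

lemma part_short: "f \<in> short d \<Longrightarrow> part length d f = 0"
  by (rule poly_mapping_eqI) (auto simp: short_iff lookup_part)

lemma part_mult_short:
  fixes f g :: "('z, 'k::ring_1) free_algebra"
  assumes f: "f \<in> short (Suc a)" and g: "g \<in> short (Suc b)"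
  shows "part length (a + b) (f * g) = part length a f * part length b g"
proof -
  define f' g' where "f' = part length a f" and "g' = part length b g"
  have "f * g = f' * g' + ((f - f') * g + f' * (g - g'))"
    by (simp add: algebra_simps)
  moreover have "(f - f') * g \<in> short (a + b)"
    using short_mult(1)[OF short_diff_part[OF f] g] by (simp add: f'_def)
  moreover have "f' * (g - g') \<in> short (a + b)"
    unfolding f'_def g'_def
    by (rule short_mult(2)[OF short_diff_part[OF g] homog_imp_short[OF part_in_homog lessI]])
  moreover have "f' * g' \<in> homog length (a + b)"
    unfolding f'_def g'_def by (intro homog_length_mult part_in_homog)
  ultimately show ?thesis
    by (simp add: part_add part_homog part_short short_add f'_def g'_def)
qed

lemma part_homog_mult:
  fixes f g :: "('z, 'k::comm_ring_1) free_algebra"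
  assumes "f \<in> homog length k"
  shows "part length d (f * g) = (if k \<le> d then f * part length (d - k) g else 0)"
proof (induction g rule: linear_induct)
  case (mon w)
  have "f * mon w \<in> homog length (k + length w)"
    by (intro homog_length_mult assms homog_single refl)
  then show ?case by (auto simp: part_homog part_single)
qed (auto simp: mult_scale part_scale part_add distrib_left)

text \<open>The deformed action on the unit preserves leading forms.\<close>

lemma act_phi_one:
  fixes g :: "(letter, 'k::field) free_algebra"
  assumes "g \<in> short (Suc d)"
  shows "act phi g 1 - g \<in> short d"
proof -
  have w: "act phi (mon w) 1 - mon w \<in> (short (length w) :: (letter, 'k) free_algebra set)" for w
  proof (induction w)
    case Nil
    show ?case using mon_Nil by (simp add: short_0_iff)
  next
    case (Cons z w)
    define v :: "(letter, 'k) free_algebra" where "v = act phi (mon w) 1"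
    have v: "v - mon w \<in> short (length w)" using Cons by (simp add: v_def)
    have "v - mon w + mon w \<in> short (Suc (length w))"
      by (intro short_add short_mono[OF v]) (simp_all add: short_def)
    then have "v \<in> short (Suc (length w))" by simp
    then have "contr z v \<in> short (Suc (length w))"
      by (auto simp: contr_def short_iff split: letter.split)
    moreover have "mon [z] * (v - mon w) \<in> short (Suc (length w))"
      using short_mult(2)[OF v, of "mon [z]" 1] by (simp add: short_def)
    moreover have "act phi (mon (z # w)) 1 - mon (z # w) = mon [z] * (v - mon w) + contr z v"
      unfolding act_Cons lin_phi by (simp add: v_def right_diff_distrib)
    ultimately show ?case by (simp add: short_add)
  qed
  have "g = (\<Sum>w\<in>keys g. scale (lookup g w) (mon w))"
    by (rule poly_mapping_eqI)
       (simp add: lookup_sum lookup_single when_def in_keys_iff if_distrib[of "(*) _"] cong: if_cong)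
  then have "act phi g 1 - g =
      act phi (\<Sum>w\<in>keys g. scale (lookup g w) (mon w)) 1 - (\<Sum>w\<in>keys g. scale (lookup g w) (mon w))"
    by simp
  also have "\<dots> = (\<Sum>w\<in>keys g. scale (lookup g w) (act phi (mon w) 1 - mon w))"
    by (simp add: act_sum_left act_scale_left scale_diff sum_subtractf)
  also have "\<dots> \<in> short d"
    using assms by (intro short_sum short_scale short_mono[OF w]) (auto simp: short_def less_Suc_eq_le)
  finally show ?thesis .
qed

text \<open>
  The leading forms of elements of \<open>I1 n\<close> belong to \<open>I0 n\<close>. Conversely, a form in \<open>I0 n\<close> is congruent
  modulo \<open>I1 n\<close> to an element of lower degree.
\<close>

lemma leading_form_I1:
  assumes "g \<in> I1 n" "g \<in> short (Suc d)"
  shows "part length d g \<in> I0 n"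
proof -
  have "part length d (act phi g 1) \<in> I0 n"
    using assms(1) by (intro I0_part) (simp add: I1_def)
  moreover have "part length d (act phi g 1) = part length d g"
    using part_short[OF act_phi_one[OF assms(2)]] by (simp add: part_diff)
  ultimately show ?thesis by simp
qed

lemma I0_leading_form:
  fixes p :: "(letter, 'k::field) free_algebra"
  assumes "n > 0" "p \<in> I0 n"
  shows "\<exists>p'\<in>short d. part length d p - p' \<in> I1 n"
  using assms(2)
proof (induction rule: I0.induct)
  case zero
  show ?case by (intro bexI[of _ 0]) (simp_all add: I1.zero_mem)
next
  case (add f g)
  then obtain f' g' where "f' \<in> short d" "part length d f - f' \<in> I1 n"
    "g' \<in> short d" "part length d g - g' \<in> I1 n" by blast
  then show ?case
    by (intro bexI[of _ "f' + g'"]) (simp_all only: part_add I1.cong_add short_add)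
next
  case (gen i j c u v)
  show ?case
  proof (cases "d = length u + 2 + length v")
    case True
    define e :: "(letter, 'k) free_algebra" where "e = (if i = j then 1 else 0)"
    have "mon u * (q n i j - e) * mon v \<in> I1 n"
      unfolding e_def by (intro I1.lmult_mem I1.rmult_mem q_cong_I1 assms(1) gen)
    then have "scale c (mon u * q n i j * mon v) - scale c (mon u * e * mon v) \<in> I1 n"
      by (simp add: I1_scale scale_diff[symmetric] algebra_simps)
    moreover have "mon u * e * mon v \<in> short d"
      using True by (auto simp: e_def short_def)
    ultimately show ?thesis
      unfolding part_homog[OF I0_gen_homog] using True by (auto intro!: bexI short_scale)
  next
    case False
    then show ?thesis
      unfolding part_homog[OF I0_gen_homog] by (intro bexI[of _ 0]) (simp_all add: I1.zero_mem)
  qed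
qed

lemma one_notin_I1: "1 \<notin> I1 n"
proof
  assume "1 \<in> (I1 n :: (letter, 'k::field) free_algebra set)"
  moreover have "(1 :: (letter, 'k) free_algebra) \<in> short (Suc 0)"
    by (simp add: short_def zero_list_def)
  ultimately have "part length 0 (1 :: (letter, 'k) free_algebra) \<in> I0 n" by (rule leading_form_I1)
  from lookup_I0_Nil[OF this] show False by (simp add: lookup_part lookup_one zero_list_def)
qed

text \<open>
  One plus the degree of the residue class of an element modulo \<open>I1 n\<close>, that is, one plus the least
  degree of its representatives; the value is zero if the class vanishes.
\<close>

definition residue_order :: "nat \<Rightarrow> (letter, 'k::field) free_algebra \<Rightarrow> nat" where
  "residue_order n f = (LEAST d. \<exists>g\<in>short d. f - g \<in> I1 n)"

lemma residue_order_le: "g \<in> short d \<Longrightarrow> f - g \<in> I1 n \<Longrightarrow> residue_order n f \<le> d"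
  unfolding residue_order_def by (intro Least_le) blast

lemma residue_order_representative: "\<exists>g\<in>short (residue_order n f). f - g \<in> I1 n"
  unfolding residue_order_def
proof (rule LeastI)
  show "\<exists>g\<in>short (Suc (Max (length ` keys f))). f - g \<in> I1 n"
    by (intro bexI[of _ f]) (auto simp: short_def less_Suc_eq_le I1.zero_mem)
qed

lemma residue_order_eq_0_iff: "residue_order n f = 0 \<longleftrightarrow> f \<in> I1 n"
  using residue_order_representative[of n f] residue_order_le[of 0 0 f n] by (auto simp: short_0_iff)

lemma leading_form_notin_I0:
  assumes "n > 0" "residue_order n f = Suc d" "g \<in> short (Suc d)" "f - g \<in> I1 n"
  shows "part length d g \<notin> I0 n"
proof
  assume "part length d g \<in> I0 n"
  from I0_leading_form[OF assms(1) this, of d]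
  obtain p where p: "p \<in> short d" "part length d g - p \<in> I1 n"
    by (auto simp: part_homog[OF part_in_homog])
  have "g - part length d g + p \<in> short d"
    by (intro short_add short_diff_part assms p)
  moreover have "f - (g - part length d g + p) \<in> I1 n"
    using I1.add_mem[OF assms(4) p(2)] by (simp add: algebra_simps)
  ultimately have "residue_order n f \<le> d" by (rule residue_order_le)
  then show False using assms(2) by simp
qed

text \<open>
  The leading forms of the terms of maximal degree satisfy a relation modulo \<open>I0 n\<close>, to which the
  graded weak algorithm applies.
\<close>

lemma weak_algorithm:
  fixes a b :: "'i \<Rightarrow> (letter, 'k::field) free_algebra"
  assumes T: "finite T" "card T < n"
    and ab: "(\<Sum>l\<in>T. a l * b l) \<in> I1 n"
    and nontriv: "\<exists>l\<in>T. a l \<notin> I1 n \<and> b l \<notin> I1 n"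
  shows "\<exists>m\<in>T. \<exists>c. residue_order n (a m - (\<Sum>l\<in>T - {m}. a l * c l)) < residue_order n (a m)"
proof -
  have n: "n > 0" using T by simp
  define S where "S = {l \<in> T. a l \<notin> I1 n \<and> b l \<notin> I1 n}"
  have S: "S \<subseteq> T" "finite S" "S \<noteq> {}" using T nontriv by (auto simp: S_def)
  define \<alpha> \<beta> where "\<alpha> l = residue_order n (a l) - 1" and "\<beta> l = residue_order n (b l) - 1" for l
  have ord_a: "residue_order n (a l) = Suc (\<alpha> l)" and ord_b: "residue_order n (b l) = Suc (\<beta> l)" if "l \<in> S" for l
    using that residue_order_eq_0_iff[of n "a l"] residue_order_eq_0_iff[of n "b l"] by (auto simp: S_def \<alpha>_def \<beta>_def)
  define rep :: "(letter, 'k) free_algebra \<Rightarrow> (letter, 'k) free_algebra"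
    where "rep f = (SOME g. g \<in> short (residue_order n f) \<and> f - g \<in> I1 n)" for f
  have rep: "rep f \<in> short (residue_order n f) \<and> f - rep f \<in> I1 n" for f
  proof -
    have "\<exists>g. g \<in> short (residue_order n f) \<and> f - g \<in> I1 n" using residue_order_representative[of n f] by blast
    then show ?thesis unfolding rep_def by (rule someI_ex)
  qed
  define a' b' where "a' l = rep (a l)" and "b' l = rep (b l)" for l
  have a': "a' l \<in> short (residue_order n (a l))" "a l - a' l \<in> I1 n"
    and b': "b' l \<in> short (residue_order n (b l))" "b l - b' l \<in> I1 n" for l
    using rep by (simp_all add: a'_def b'_def)
  define A B where "A l = part length (\<alpha> l) (a' l)" and "B l = part length (\<beta> l) (b' l)" for l
  define d where "d = Max ((\<lambda>l. \<alpha> l + \<beta> l) ` S)"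
  define T' where "T' = {l \<in> S. \<alpha> l + \<beta> l = d}"
  have d: "\<alpha> l + \<beta> l \<le> d" if "l \<in> S" for l using that S by (auto simp: d_def)
  have "d \<in> (\<lambda>l. \<alpha> l + \<beta> l) ` S" unfolding d_def using S by (intro Max_in) auto
  then have T': "T' \<noteq> {}" "T' \<subseteq> S" "finite T'" using S by (auto simp: T'_def)
  have "card T' < n" using card_mono[OF T(1) subset_trans[OF T'(2) S(1)]] T(2) by simp
  have a's: "a' l \<in> short (Suc (\<alpha> l))" and b's: "b' l \<in> short (Suc (\<beta> l))" if "l \<in> S" for l
    using a'(1)[of l] b'(1)[of l] ord_a[OF that] ord_b[OF that] by simp_all
  have fI: "(\<Sum>l\<in>S. a' l * b' l) \<in> I1 n"
  proof -
    have "(\<Sum>l\<in>T - S. a l * b l) \<in> I1 n"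
      by (intro I1.sum_mem) (auto simp: S_def intro: I1.lmult_mem I1.rmult_mem)
    moreover have "(\<Sum>l\<in>T. a l * b l) = (\<Sum>l\<in>T - S. a l * b l) + (\<Sum>l\<in>S. a l * b l)"
      by (rule sum.subset_diff[OF S(1) T(1)])
    ultimately have "(\<Sum>l\<in>S. a l * b l) \<in> I1 n" using I1.diff_mem[OF ab] by fastforce
    moreover have "(\<Sum>l\<in>S. a' l * b' l) - (\<Sum>l\<in>S. a l * b l) \<in> I1 n"
      by (intro I1.cong_sum I1.cong_mult) (use a' b' I1.cong_sym in blast)+
    ultimately show ?thesis using I1.cong_mem by blast
  qed
  have fs: "(\<Sum>l\<in>S. a' l * b' l) \<in> short (Suc d)"
  proof (intro short_sum)
    fix l assume l: "l \<in> S"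
    have "a' l * b' l \<in> short (Suc (\<alpha> l) + \<beta> l)" by (rule short_mult(1)[OF a's[OF l] b's[OF l]])
    then show "a' l * b' l \<in> short (Suc d)" using d[OF l] by (auto intro: short_mono)
  qed
  have "part length d (\<Sum>l\<in>S. a' l * b' l) = (\<Sum>l\<in>S. part length d (a' l * b' l))"
    by (rule part_sum)
  also have "\<dots> = (\<Sum>l\<in>T'. A l * B l)"
  proof (intro sum.mono_neutral_cong_right ballI)
    show "part length d (a' l * b' l) = A l * B l" if "l \<in> T'" for l
      using that part_mult_short[OF a's b's, of l l] by (auto simp: T'_def A_def B_def)
    show "part length d (a' l * b' l) = 0" if "l \<in> S - T'" for l
    proof (rule part_short)
      have "\<alpha> l + \<beta> l < d" using that d[of l] by (auto simp: T'_def)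
      then show "a' l * b' l \<in> short d"
        using short_mult(1)[OF a's b's, of l l] that by (auto intro: short_mono)
    qed
  qed (use S T' in auto)
  finally have AB: "(\<Sum>l\<in>T'. A l * B l) \<in> I0 n"
    using leading_form_I1[OF fI fs] by simp
  have "B l \<notin> I0 n" if "l \<in> T'" for l
    unfolding B_def using that T' b' b's by (intro leading_form_notin_I0[OF n ord_b]) auto
  moreover have "B l \<in> homog length (\<beta> l)" for l
    unfolding B_def by (rule part_in_homog)
  ultimately obtain m C where m: "m \<in> T'" and C: "A m - (\<Sum>l\<in>T' - {m}. A l * C l) \<in> I0 n"
    using graded_weak_algorithm[OF T'(3) \<open>card T' < n\<close> T'(1) _ _ AB] by blast
  \<comment> \<open>The components of the coefficients \<open>C l\<close> that contribute to the degree of \<open>A m\<close>.\<close>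
  define c where "c l = (if l \<in> T' \<and> \<alpha> l \<le> \<alpha> m then part length (\<alpha> m - \<alpha> l) (C l) else 0)" for l
  define h where "h = a' m - (\<Sum>l\<in>T' - {m}. a' l * c l)"
  have mS: "m \<in> S" using m T' by auto
  have Ah: "A l \<in> homog length (\<alpha> l)" for l unfolding A_def by (rule part_in_homog)
  have ac: "a' l * c l \<in> short (Suc (\<alpha> m)) \<and> part length (\<alpha> m) (a' l * c l) = part length (\<alpha> m) (A l * C l)"
    if l: "l \<in> T'" for l
  proof (cases "\<alpha> l \<le> \<alpha> m")
    case True
    have cl: "c l = part length (\<alpha> m - \<alpha> l) (C l)" using True l by (simp add: c_def)
    have cs: "c l \<in> short (Suc (\<alpha> m - \<alpha> l))"
      unfolding cl by (rule homog_imp_short[OF part_in_homog]) simp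
    have lS: "l \<in> S" using l T' by auto
    have "part length (\<alpha> l + (\<alpha> m - \<alpha> l)) (a' l * c l) = A l * part length (\<alpha> m - \<alpha> l) (c l)"
      unfolding A_def by (rule part_mult_short[OF a's[OF lS] cs])
    then show ?thesis
      using True short_mult(1)[OF a's[OF lS] cs]
      by (simp add: part_homog_mult[OF Ah] cl part_homog[OF part_in_homog])
  next
    case False
    then show ?thesis by (simp add: c_def part_homog_mult[OF Ah])
  qed
  have hs: "h \<in> short (Suc (\<alpha> m))"
    unfolding h_def using ac a's[OF mS] by (intro short_diff short_sum) auto
  have "part length (\<alpha> m) h = part length (\<alpha> m) (A m - (\<Sum>l\<in>T' - {m}. A l * C l))"
    unfolding h_def using ac by (simp add: part_diff part_sum A_def part_homog[OF part_in_homog])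
  then have hI: "part length (\<alpha> m) h \<in> I0 n" using I0_part[OF C] by simp
  from I0_leading_form[OF n this, of "\<alpha> m"]
  obtain p where p: "p \<in> short (\<alpha> m)" "part length (\<alpha> m) h - p \<in> I1 n"
    by (auto simp: part_homog[OF part_in_homog])
  have "(\<Sum>l\<in>T - {m}. a l * c l) = (\<Sum>l\<in>T' - {m}. a l * c l)"
    using T' S T(1) by (intro sum.mono_neutral_right) (auto simp: c_def)
  then have "(a m - (\<Sum>l\<in>T - {m}. a l * c l)) - h =
      (a m - a' m) - ((\<Sum>l\<in>T' - {m}. a l * c l) - (\<Sum>l\<in>T' - {m}. a' l * c l))"
    by (simp add: h_def)
  also have "\<dots> \<in> I1 n"
    by (rule I1.diff_mem[OF a'(2) I1.cong_sum[OF I1.cong_mult]]) (simp_all add: I1.zero_mem a'(2))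
  finally have "(a m - (\<Sum>l\<in>T - {m}. a l * c l)) - h \<in> I1 n" .
  from I1.add_mem[OF this p(2)]
  have "(a m - (\<Sum>l\<in>T - {m}. a l * c l)) - (h - part length (\<alpha> m) h + p) \<in> I1 n"
    by (simp add: algebra_simps)
  moreover have "h - part length (\<alpha> m) h + p \<in> short (\<alpha> m)"
    by (intro short_add short_diff_part hs p)
  ultimately have "residue_order n (a m - (\<Sum>l\<in>T - {m}. a l * c l)) \<le> \<alpha> m" by (intro residue_order_le)
  then have "residue_order n (a m - (\<Sum>l\<in>T - {m}. a l * c l)) < residue_order n (a m)" using ord_a[OF mS] by simp
  then show ?thesis using mS S by blast
qed

text \<open>
  By the weak algorithm, elementary column operations lower the orders of the entries in the row \<open>i0\<close>
  of \<open>A\<close> as long as one of its nonzero entries meets a nonzero entry of a column of \<open>B\<close> other than the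
  column \<open>i0\<close>. When this is no longer possible, some nonzero entry of the row \<open>i0\<close>, say in the column
  \<open>l\<close>, meets only zeros there, and the indices \<open>i0\<close> and \<open>l\<close> can be removed.
\<close>

theorem no_identity_factorization_I1:
  fixes A :: "'r \<Rightarrow> 's \<Rightarrow> (letter, 'k::field) free_algebra" and B :: "'s \<Rightarrow> 'r \<Rightarrow> (letter, 'k) free_algebra"
  assumes "finite T" "finite M" "card T < card M" "card T < n"
    and "\<And>i j. i \<in> M \<Longrightarrow> j \<in> M \<Longrightarrow> (\<Sum>l\<in>T. A i l * B l j) - (if i = j then 1 else 0) \<in> I1 n"
  shows False
  using assms
proof (induction "card T" arbitrary: T M A B rule: less_induct)
  case outer: (less T M)
  note T = outer.prems(1,4) and M = outer.prems(2)
  obtain i0 where i0: "i0 \<in> M" using outer.prems(3) by fastforce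
  have False
    if "\<And>i j. i \<in> M \<Longrightarrow> j \<in> M \<Longrightarrow> (\<Sum>l\<in>T. A i l * B l j) - (if i = j then 1 else 0) \<in> I1 n"
    for A :: "'r \<Rightarrow> 's \<Rightarrow> (letter, 'k) free_algebra" and B
    using that
  proof (induction "\<Sum>l\<in>T. residue_order n (A i0 l)" arbitrary: A B rule: less_induct)
    case inner: (less A B)
    note AB = inner.prems
    show ?case
    proof (cases "\<exists>j\<in>M - {i0}. \<exists>l\<in>T. A i0 l \<notin> I1 n \<and> B l j \<notin> I1 n")
      case True
      then obtain j where j: "j \<in> M" "j \<noteq> i0" "\<exists>l\<in>T. A i0 l \<notin> I1 n \<and> B l j \<notin> I1 n" by blast
      have "(\<Sum>l\<in>T. A i0 l * B l j) \<in> I1 n" using AB[OF i0 j(1)] j(2) by simp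
      from weak_algorithm[OF T this j(3)] obtain m c where m: "m \<in> T"
        and lt: "residue_order n (A i0 m - (\<Sum>l\<in>T - {m}. A i0 l * c l)) < residue_order n (A i0 m)" by blast
      define A' where "A' i l = (if l = m then A i m - (\<Sum>l\<in>T - {m}. A i l * c l) else A i l)" for i l
      define B' where "B' l j = (if l = m then B m j else B l j + c l * B m j)" for l j
      show False
      proof (rule inner.hyps)
        have "(\<Sum>l\<in>T. residue_order n (A' i0 l)) = residue_order n (A' i0 m) + (\<Sum>l\<in>T - {m}. residue_order n (A i0 l))"
          using T m by (subst sum.remove[of T m]) (auto simp: A'_def)
        also have "\<dots> < residue_order n (A i0 m) + (\<Sum>l\<in>T - {m}. residue_order n (A i0 l))"
          using lt by (simp add: A'_def)
        also have "\<dots> = (\<Sum>l\<in>T. residue_order n (A i0 l))"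
          using T m by (simp add: sum.remove)
        finally show "(\<Sum>l\<in>T. residue_order n (A' i0 l)) < (\<Sum>l\<in>T. residue_order n (A i0 l))" .
        fix i j assume ij: "i \<in> M" "j \<in> M"
        have "(\<Sum>l\<in>T. A' i l * B' l j) = A' i m * B' m j + (\<Sum>l\<in>T - {m}. A' i l * B' l j)"
          using T m by (simp add: sum.remove)
        also have "(\<Sum>l\<in>T - {m}. A' i l * B' l j) =
            (\<Sum>l\<in>T - {m}. A i l * B l j) + (\<Sum>l\<in>T - {m}. A i l * c l) * B m j"
          by (simp add: A'_def B'_def distrib_left sum.distrib sum_distrib_right mult.assoc)
        also have "A' i m * B' m j = A i m * B m j - (\<Sum>l\<in>T - {m}. A i l * c l) * B m j"
          by (simp add: A'_def B'_def left_diff_distrib)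
        finally have "(\<Sum>l\<in>T. A' i l * B' l j) = A i m * B m j + (\<Sum>l\<in>T - {m}. A i l * B l j)"
          by simp
        also have "\<dots> = (\<Sum>l\<in>T. A i l * B l j)" using T m by (simp add: sum.remove)
        finally show "(\<Sum>l\<in>T. A' i l * B' l j) - (if i = j then 1 else 0) \<in> I1 n"
          using AB[OF ij] by simp
      qed
    next
      case False
      have "\<exists>l\<in>T. A i0 l \<notin> I1 n"
      proof (rule ccontr)
        assume "\<not> ?thesis"
        then have "(\<Sum>l\<in>T. A i0 l * B l i0) \<in> I1 n" by (intro I1.sum_mem I1.rmult_mem) blast
        from I1.diff_mem[OF this AB[OF i0 i0]] show False by (simp add: one_notin_I1)
      qed
      then obtain l where l: "l \<in> T" "A i0 l \<notin> I1 n" by blast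
      have c: "card (T - {l}) < card T" using T(1) l(1) by (rule card_Diff1_less)
      show False
      proof (rule outer.hyps[OF c])
        show "finite (T - {l})" "finite (M - {i0})" using T M by simp_all
        show "card (T - {l}) < card (M - {i0})" "card (T - {l}) < n"
          using c outer.prems(3) T l i0 by (simp_all add: card_Diff_singleton)
        fix i j assume ij: "i \<in> M - {i0}" "j \<in> M - {i0}"
        have "A i l * B l j \<in> I1 n" using False ij l by (intro I1.lmult_mem) blast
        moreover have "(\<Sum>l\<in>T. A i l * B l j) = A i l * B l j + (\<Sum>l\<in>T - {l}. A i l * B l j)"
          using T l by (simp add: sum.remove)
        ultimately show "(\<Sum>l\<in>T - {l}. A i l * B l j) - (if i = j then 1 else 0) \<in> I1 n"
          using I1.diff_mem[OF AB, of i j "A i l * B l j"] ij by simp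
      qed
    qed
  qed
  then show ?case using outer.prems(5) by blast
qed

section \<open>Specialization of letters\<close>

text \<open>
  The endomorphism \<open>subst\<close> of the free algebra maps \<open>u\<^sub>0\<close> and \<open>v\<^sub>0\<close> to \<open>1\<close>, the other \<open>u\<^sub>i\<close> and \<open>v\<^sub>i\<close> to \<open>0\<close>,
  and fixes the remaining letters.
\<close>

definition subst_letter :: "letter \<Rightarrow> (letter, 'k::field) free_algebra" where
  "subst_letter z = (case z of Lu i \<Rightarrow> if i = 0 then 1 else 0 | Lv i \<Rightarrow> if i = 0 then 1 else 0 | _ \<Rightarrow> mon [z])"

definition subst :: "(letter, 'k::field) free_algebra \<Rightarrow> (letter, 'k) free_algebra" where
  "subst f = act (\<lambda>z w. subst_letter z * mon w) f 1"

lemma lin_subst_letter: "lin (\<lambda>w. subst_letter z * mon w) f = subst_letter z * f"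
  by (induction f rule: linear_induct) (simp_all add: lin_scale lin_add mult_scale distrib_left)

lemma act_subst: "act (\<lambda>z w. subst_letter z * mon w) f v = subst f * v"
proof -
  let ?a = "\<lambda>z w. subst_letter z * mon w :: (letter, 'a) free_algebra"
  have "act ?a (mon w) v = act ?a (mon w) 1 * v" for w
    by (induction w) (simp_all add: act_Cons lin_subst_letter mult.assoc)
  then show ?thesis unfolding subst_def
    by (induction f rule: linear_induct)
       (simp_all add: act_scale_left act_add_left scale_mult distrib_right)
qed

lemma subst_zero [simp]: "subst 0 = 0"
  and subst_one [simp]: "subst 1 = 1"
  and subst_add: "subst (f + g) = subst f + subst g"
  and subst_diff: "subst (f - g) = subst f - subst g"
  and subst_sum: "subst (sum F A) = (\<Sum>a\<in>A. subst (F a))"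
  by (simp_all add: subst_def act_add_left act_diff_left act_sum_left)

lemma subst_mult: "subst (f * g) = subst f * subst g"
  using act_subst[of f "subst g"] by (simp add: subst_def act_mult)

lemma subst_Cons: "subst (mon (z # w)) = subst_letter z * subst (mon w)"
  by (simp add: subst_def act_Cons lin_subst_letter)

lemma subst_Nil [simp]: "subst (mon []) = 1"
  by (simp add: subst_def)

lemma subst_q: "subst (q n i j) = (q n i j :: (letter, 'k::field) free_algebra)"
proof -
  have "subst (mon [Lx i r, Ly r j]) = (mon [Lx i r, Ly r j] :: (letter, 'k) free_algebra)" for r
    by (simp add: subst_Cons subst_letter_def)
  then show ?thesis by (simp add: q_def subst_sum)
qed

section \<open>A representation of Cuntz type\<close>

text \<open>
  The image of the basis vector \<open>k\<close> under a letter. The operators \<open>out i\<close> with \<open>i \<le> n\<close> are isometries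
  whose ranges decompose the whole space, and the \<open>inn i\<close> are their transposes. For \<open>i > n\<close> both are zero.
\<close>

definition cuntz :: "nat \<Rightarrow> letter \<Rightarrow> nat \<Rightarrow> (nat \<Rightarrow>\<^sub>0 'k::field)" where
  "cuntz n z k = (let out = (\<lambda>i. if i \<le> n then mon (k * Suc n + i) else 0);
      inn = (\<lambda>i. if k mod Suc n = i then mon (k div Suc n) else 0)
    in case z of Lx i r \<Rightarrow> if r = 0 then inn i else 0 | Ly r j \<Rightarrow> if r = 0 then out j else 0
      | Lu i \<Rightarrow> out i | Lv i \<Rightarrow> inn i)"

text \<open>The annihilator of this representation.\<close>

definition annih :: "nat \<Rightarrow> (letter, 'k::field) free_algebra set" where
  "annih n = {f. \<forall>v. act (cuntz n) f v = 0}"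

interpretation annih: two_sided_ideal "annih n"
  by standard (auto simp: annih_def act_add_left act_mult)

lemma annihI:
  assumes "\<And>k. act (cuntz n) f (mon k) = act (cuntz n) g (mon k)"
  shows "f - g \<in> annih n"
proof -
  have "act (cuntz n) (f - g) v = 0" for v
    by (induction v rule: linear_induct)
       (simp_all add: act_scale act_add act_diff_left assms)
  then show ?thesis by (simp add: annih_def)
qed

lemma q_cong_annih:
  assumes "n > 0" "i \<le> n" "j \<le> n"
  shows "q n i j - (if i = j then 1 else 0) \<in> (annih n :: (letter, 'k::field) free_algebra set)"
proof (rule annihI)
  fix k
  have "(k * Suc n + j) mod Suc n = j" "(k * Suc n + j) div Suc n = k"
    using assms by (simp_all del: mult_Suc_right)
  then have "act (cuntz n) (mon [Lx i r, Ly r j]) (mon k) =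
      (if r = 0 then if i = j then mon k else 0 else 0 :: nat \<Rightarrow>\<^sub>0 'k)" for r
    using assms by (auto simp: act_Cons cuntz_def simp del: mult_Suc_right)
  then show "act (cuntz n) (q n i j) (mon k) =
      (act (cuntz n) (if i = j then 1 else 0) (mon k) :: nat \<Rightarrow>\<^sub>0 'k)"
    using assms(1) by (simp add: q_def act_sum_left)
qed

lemma uv_cong_annih:
  "(\<Sum>i\<le>n. mon [Lu i, Lv i]) - 1 \<in> (annih n :: (letter, 'k::field) free_algebra set)"
proof (rule annihI)
  fix k
  have "act (cuntz n) (mon [Lu i, Lv i]) (mon k) =
      (if i = k mod Suc n then mon k else 0 :: nat \<Rightarrow>\<^sub>0 'k)" if "i \<le> n" for i
    using that div_mult_mod_eq[of k "Suc n"] by (auto simp: act_Cons cuntz_def simp del: mult_Suc_right)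
  then have "act (cuntz n) (\<Sum>i\<le>n. mon [Lu i, Lv i]) (mon k) =
      (\<Sum>i\<le>n. if i = k mod Suc n then mon k else 0 :: nat \<Rightarrow>\<^sub>0 'k)"
    unfolding act_sum_left by (intro sum.cong) auto
  then show "act (cuntz n) (\<Sum>i\<le>n. mon [Lu i, Lv i]) (mon k) =
      (act (cuntz n) 1 (mon k) :: nat \<Rightarrow>\<^sub>0 'k)"
    by (simp add: less_Suc_eq_le[symmetric])
qed

text \<open>The grading of the free algebra by the integers.\<close>

definition deg_letter :: "letter \<Rightarrow> int" where
  "deg_letter z = (case z of Lx _ _ \<Rightarrow> 1 | Lv _ \<Rightarrow> 1 | _ \<Rightarrow> - 1)"

definition word_deg :: "letter list \<Rightarrow> int" where
  "word_deg w = (\<Sum>z\<leftarrow>w. deg_letter z)"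

lemma deg_Nil [simp]: "word_deg [] = 0"
  and deg_Cons [simp]: "word_deg (z # w) = deg_letter z + word_deg w"
  and deg_append: "word_deg (u @ v) = word_deg u + word_deg v"
  by (simp_all add: word_deg_def)

lemma deg_le_length: "word_deg w \<le> int (length w)"
  by (induction w) (auto simp: deg_letter_def split: letter.split)

lemmas homog_deg_mult = homog_mult[where d = word_deg, OF deg_append]

lemma homog_deg_one: "1 \<in> homog word_deg 0"
  by (simp add: homog_def zero_list_def)

text \<open>The span of the basis vectors with numbers less than \<open>b\<close>.\<close>

definition below :: "nat \<Rightarrow> (nat \<Rightarrow>\<^sub>0 'k::field) set" where
  "below b = {v. \<forall>x\<ge>b. lookup v x = 0}"

lemma below_sum: "(\<And>a. a \<in> A \<Longrightarrow> f a \<in> below b) \<Longrightarrow> sum f A \<in> below b"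
  by (simp add: below_def lookup_sum)

lemma below_scale: "v \<in> below b \<Longrightarrow> scale c v \<in> below b"
  by (simp add: below_def)

lemma lin_below:
  assumes "v \<in> below b" "\<And>x. x < b \<Longrightarrow> a x \<in> below b'"
  shows "lin a v \<in> below b'"
  unfolding lin_def
proof (intro below_sum below_scale assms(2))
  fix x assume "x \<in> keys v"
  then show "x < b" using assms(1) by (auto simp: below_def in_keys_iff not_le[symmetric])
qed

text \<open>
  A letter of degree \<open>1\<close> divides the numbers of basis vectors by \<open>n + 1\<close>, a letter of degree \<open>-1\<close>
  multiplies them. The bound on the length of the word keeps the exponent positive before each
  division.
\<close>

lemma act_word_below:
  assumes "length w \<le> p" "v \<in> below (Suc n ^ p)" "int e = int p - word_deg w"
  shows "act (cuntz n) (mon w) v \<in> below (Suc n ^ e)"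
  using assms(1,3)
proof (induction w arbitrary: e)
  case Nil
  then show ?case using assms(2) by simp
next
  case (Cons z w)
  define e' where "e' = nat (int p - word_deg w)"
  have e': "int e' = int p - word_deg w" "e' > 0"
    using Cons.prems(1) deg_le_length[of w] by (auto simp: e'_def)
  have IH: "act (cuntz n) (mon w) v \<in> below (Suc n ^ e')"
    using Cons.prems(1) e' by (intro Cons.IH) auto
  show ?case unfolding act_Cons
  proof (rule lin_below[OF IH])
    fix x assume x: "x < Suc n ^ e'"
    have inn: "x div Suc n < Suc n ^ e" if "e' = Suc e"
      using x that by (simp add: div_less_iff_less_mult mult.commute del: mult_Suc mult_Suc_right)
    have out: "\<not> Suc n ^ e \<le> x * Suc n + i" if "i \<le> n" "e = Suc e'" for i
    proof -
      have "x * Suc n + i < Suc x * Suc n" using that by simp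
      also have "\<dots> \<le> Suc n ^ e' * Suc n" using x by (intro mult_right_mono) auto
      finally show ?thesis using that by (simp add: mult.commute not_le)
    qed
    have "deg_letter z = 1 \<Longrightarrow> e' = Suc e" "deg_letter z = - 1 \<Longrightarrow> e = Suc e'"
      using Cons.prems(2) e' by auto
    then show "cuntz n z x \<in> below (Suc n ^ e)"
      using inn out
      by (cases z) (auto simp: cuntz_def Let_def below_def lookup_single when_def deg_letter_def
          simp del: mult_Suc mult_Suc_right)
  qed
qed

lemma act_below:
  fixes f :: "(letter, 'k::field) free_algebra"
  assumes "f \<in> homog word_deg 0" "f \<in> short (Suc p)" "v \<in> below (Suc n ^ p)"
  shows "act (cuntz n) f v \<in> below (Suc n ^ p)"
proof -
  have "act (cuntz n) f v = (\<Sum>w\<in>keys f. scale (lookup f w) (act (cuntz n) (mon w) v))"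
    by (simp add: act_def lin_def)
  also have "\<dots> \<in> below (Suc n ^ p)"
    using assms by (intro below_sum below_scale act_word_below)
      (auto simp: homog_def short_def less_Suc_eq_le)
  finally show ?thesis .
qed

lemma common_length_bound:
  assumes "finite F"
  shows "\<exists>p. F \<subseteq> short (Suc p)"
proof -
  have fin: "finite (\<Union>f\<in>F. length ` keys f)" using assms by simp
  show ?thesis
    by (rule exI[of _ "Max (\<Union>f\<in>F. length ` keys f)"])
       (auto simp: short_def less_Suc_eq_le intro!: Max_ge[OF fin])
qed

theorem no_identity_factorization_degree_zero:
  fixes A B :: "nat \<Rightarrow> nat \<Rightarrow> (letter, 'k::field) free_algebra"
  assumes hom: "\<And>i l. A i l \<in> homog word_deg 0" "\<And>l j. B l j \<in> homog word_deg 0"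
    and AB: "\<And>i j. i \<le> k \<Longrightarrow> j \<le> k \<Longrightarrow> (\<Sum>l<k. A i l * B l j) - (if i = j then 1 else 0) \<in> annih n"
  shows False
proof -
  have "finite ((\<lambda>(i, l). A i l) ` ({..k} \<times> {..<k}) \<union> (\<lambda>(l, j). B l j) ` ({..<k} \<times> {..k}))"
    by simp
  from common_length_bound[OF this] obtain p where
    "(\<lambda>(i, l). A i l) ` ({..k} \<times> {..<k}) \<union> (\<lambda>(l, j). B l j) ` ({..<k} \<times> {..k}) \<subseteq> short (Suc p)"
    by blast
  then have p: "\<And>i l. i \<le> k \<Longrightarrow> l < k \<Longrightarrow> A i l \<in> short (Suc p)" "\<And>l j. l < k \<Longrightarrow> j \<le> k \<Longrightarrow> B l j \<in> short (Suc p)"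
    by (simp_all add: image_subset_iff)
  define N where "N = Suc n ^ p"
  define S M where "S = {..<k} \<times> {..<N}" and "M = {..k} \<times> {..<N}"
  define A' where "A' = (\<lambda>(i, x) (l, y). lookup (act (cuntz n) (A i l) (mon y)) x)"
  define B' where "B' = (\<lambda>(l, y) (j, x). lookup (act (cuntz n) (B l j) (mon x)) y)"
  have "card M \<le> card S"
  proof (rule identity_matrix_factorization_field[of S M A' B'])
    show "finite S" "finite M" by (simp_all add: S_def M_def)
    fix a b assume "a \<in> M" "b \<in> M"
    then obtain i x j x' where ab: "a = (i, x)" "b = (j, x')" "i \<le> k" "j \<le> k" "x < N" "x' < N"
      by (auto simp: M_def)
    have "(\<Sum>y<N. A' a (l, y) * B' (l, y) b) =
        lookup (act (cuntz n) (A i l * B l j) (mon x')) x" if l: "l < k" for l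
    proof -
      define v where "v = act (cuntz n) (B l j) (mon x')"
      have "(mon x' :: nat \<Rightarrow>\<^sub>0 'k) \<in> below N" using ab by (simp add: below_def lookup_single)
      then have v: "v \<in> below N"
        unfolding v_def N_def by (intro act_below hom p l ab)
      have "v = (\<Sum>y<N. scale (lookup v y) (mon y))"
        using v by (intro poly_mapping_eqI)
          (auto simp: lookup_sum lookup_single when_def below_def if_distrib[of "(*) _"] cong: if_cong)
      then have "act (cuntz n) (A i l) v = act (cuntz n) (A i l) (\<Sum>y<N. scale (lookup v y) (mon y))"
        by simp
      also have "\<dots> = (\<Sum>y<N. scale (lookup v y) (act (cuntz n) (A i l) (mon y)))"
        by (simp add: act_sum act_scale)
      finally show ?thesis
        by (simp add: act_mult lookup_sum A'_def B'_def ab mult.commute flip: v_def)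
    qed
    moreover have "(\<Sum>s\<in>S. A' a s * B' s b) = (\<Sum>l<k. \<Sum>y<N. A' a (l, y) * B' (l, y) b)"
      by (simp add: S_def sum.cartesian_product case_prod_unfold)
    ultimately have "(\<Sum>s\<in>S. A' a s * B' s b) =
        (\<Sum>l<k. lookup (act (cuntz n) (A i l * B l j) (mon x')) x)"
      by simp
    also have "\<dots> = lookup (act (cuntz n) (\<Sum>l<k. A i l * B l j) (mon x')) x"
      by (simp add: act_sum_left lookup_sum)
    also have "act (cuntz n) (\<Sum>l<k. A i l * B l j) (mon x') =
        act (cuntz n) (if i = j then 1 else 0) (mon x')"
      using AB[OF ab(3,4)] by (simp add: annih_def act_diff_left)
    finally show "(\<Sum>s\<in>S. A' a s * B' s b) = (if a = b then 1 else 0)"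
      using ab by (auto simp: lookup_single when_def)
  qed
  moreover have "N > 0" by (simp add: N_def)
  ultimately show False by (simp add: S_def M_def)
qed

section \<open>The graded ideal\<close>

text \<open>
  The elements whose homogeneous components all lie in \<open>H\<close>. If \<open>H\<close> is an ideal and the grading is
  additive, this is the largest graded ideal contained in \<open>H\<close>.
\<close>

definition graded_core :: "('w \<Rightarrow> 'd) \<Rightarrow> ('w \<Rightarrow>\<^sub>0 'k::zero) set \<Rightarrow> ('w \<Rightarrow>\<^sub>0 'k) set" where
  "graded_core d H = {f. \<forall>k. part d k f \<in> H}"

lemma part_mult_mon:
  fixes f :: "('z, 'k::comm_ring_1) free_algebra" and d :: "'z list \<Rightarrow> 'd::ab_group_add"
  assumes d: "\<And>u v. d (u @ v) = d u + d v"
  shows "part d k (mon w * f) = mon w * part d (k - d w) f"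
    and "part d k (f * mon w) = part d (k - d w) f * mon w"
proof -
  show "part d k (mon w * f) = mon w * part d (k - d w) f"
    by (induction f rule: linear_induct)
       (auto simp: mult_scale part_scale distrib_left part_add part_single d)
  show "part d k (f * mon w) = part d (k - d w) f * mon w"
    by (induction f rule: linear_induct)
       (auto simp: scale_mult part_scale distrib_right part_add part_single d)
qed

lemma two_sided_ideal_graded_core:
  fixes H :: "('z, 'k::comm_ring_1) free_algebra set" and d :: "'z list \<Rightarrow> 'd::ab_group_add"
  assumes "two_sided_ideal H" and d: "\<And>u v. d (u @ v) = d u + d v"
  shows "two_sided_ideal (graded_core d H)"
proof -
  interpret H: two_sided_ideal H by fact
  have H_scale: "scale c f \<in> H" if "f \<in> H" for c f
    using that by (simp add: scale_eq_mult H.lmult_mem)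
  show ?thesis
  proof
    fix f g :: "('z, 'k) free_algebra"
    assume f: "f \<in> graded_core d H"
    show "g * f \<in> graded_core d H"
      using f by (induction g rule: linear_induct)
        (auto simp: graded_core_def part_mult_mon[of d, OF d] scale_mult part_scale distrib_right
           part_add H.zero_mem H.add_mem H.lmult_mem H_scale)
    show "f * g \<in> graded_core d H"
      using f by (induction g rule: linear_induct)
        (auto simp: graded_core_def part_mult_mon[of d, OF d] mult_scale part_scale distrib_left
           part_add H.zero_mem H.add_mem H.rmult_mem H_scale)
  qed (auto simp: graded_core_def part_add H.zero_mem H.add_mem)
qed

lemma graded_core_part: "f \<in> graded_core d H \<Longrightarrow> part d k f \<in> H"
  by (simp add: graded_core_def)

lemma homog_graded_core: "f \<in> homog d k \<Longrightarrow> f \<in> H \<Longrightarrow> 0 \<in> H \<Longrightarrow> f \<in> graded_core d H"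
  by (auto simp: graded_core_def part_homog)

lemma graded_core_part_mem: "f \<in> graded_core d H \<Longrightarrow> 0 \<in> H \<Longrightarrow> part d k f \<in> graded_core d H"
  by (intro homog_graded_core[OF part_in_homog] graded_core_part)

text \<open>The preimage of \<open>I1 n\<close> under the specialization, intersected with the annihilator.\<close>

definition H :: "nat \<Rightarrow> (letter, 'k::field) free_algebra set" where
  "H n = {f. subst f \<in> I1 n} \<inter> annih n"

interpretation H: two_sided_ideal "H n"
  by standard (auto simp: H_def subst_add subst_mult I1.zero_mem I1.add_mem I1.lmult_mem I1.rmult_mem
      annih.zero_mem annih.add_mem annih.lmult_mem annih.rmult_mem)

text \<open>The ideal of relations of the graded ring.\<close>

definition J :: "nat \<Rightarrow> (letter, 'k::field) free_algebra set" where
  "J n = graded_core word_deg (H n)"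

interpretation J: two_sided_ideal "J n"
  unfolding J_def by (rule two_sided_ideal_graded_core[OF H.two_sided_ideal_axioms deg_append])

lemma J_subset_H: "J n \<subseteq> H n"
proof
  fix f assume f: "f \<in> J n"
  have "(\<Sum>k\<in>word_deg ` keys f. part word_deg k f) \<in> H n"
    using f by (intro H.sum_mem) (simp add: J_def graded_core_part)
  then show "f \<in> H n" by (simp add: sum_part)
qed

lemma q_cong_J:
  assumes "n > 0" "i \<le> n" "j \<le> n"
  shows "q n i j - (if i = j then 1 else 0) \<in> J n"
  unfolding J_def
proof (rule homog_graded_core)
  show "q n i j - (if i = j then 1 else 0) \<in> homog word_deg 0"
    unfolding q_def
    by (auto intro!: homog_diff homog_sum homog_single homog_deg_one simp: deg_letter_def)
  show "q n i j - (if i = j then 1 else 0) \<in> H n"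
    using q_cong_I1[OF assms] q_cong_annih[OF assms] by (auto simp: H_def subst_diff subst_q)
qed (rule H.zero_mem)

lemma uv_cong_J: "(\<Sum>i\<le>n. mon [Lu i, Lv i]) - 1 \<in> (J n :: (letter, 'k::field) free_algebra set)"
  unfolding J_def
proof (rule homog_graded_core)
  show "(\<Sum>i\<le>n. mon [Lu i, Lv i]) - 1 \<in> (homog word_deg 0 :: (letter, 'k) free_algebra set)"
    by (auto intro!: homog_diff homog_sum homog_single homog_deg_one simp: deg_letter_def)
  have "subst (mon [Lu i, Lv i]) = (if i = 0 then 1 else 0 :: (letter, 'k) free_algebra)" for i
    by (simp add: subst_Cons subst_letter_def)
  then have "subst ((\<Sum>i\<le>n. mon [Lu i, Lv i]) - 1) = (0 :: (letter, 'k) free_algebra)"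
    by (simp add: subst_diff subst_sum)
  then show "(\<Sum>i\<le>n. mon [Lu i, Lv i]) - 1 \<in> (H n :: (letter, 'k) free_algebra set)"
    using uv_cong_annih by (auto simp: H_def I1.zero_mem)
qed (rule H.zero_mem)

theorem no_identity_factorization_J:
  fixes A B :: "nat \<Rightarrow> nat \<Rightarrow> (letter, 'k::field) free_algebra"
  assumes "k < n"
    and AB: "\<And>i j. i \<le> k \<Longrightarrow> j \<le> k \<Longrightarrow> (\<Sum>l<k. A i l * B l j) - (if i = j then 1 else 0) \<in> J n"
  shows False
proof (rule no_identity_factorization_I1[of "{..<k}" "{..k}" n
      "\<lambda>i l. subst (A i l)" "\<lambda>l j. subst (B l j)"])
  fix i j assume "i \<in> {..k}" "j \<in> {..k}"
  then have "subst ((\<Sum>l<k. A i l * B l j) - (if i = j then 1 else 0)) \<in> I1 n"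
    using subsetD[OF J_subset_H AB[of i j]] by (simp add: H_def)
  then show "(\<Sum>l<k. subst (A i l) * subst (B l j)) - (if i = j then 1 else 0) \<in> I1 n"
    by (simp add: subst_diff subst_sum subst_mult split: if_splits)
qed (use assms(1) in auto)

section \<open>Products of homogeneous components\<close>

text \<open>The additive subgroup generated by the products of elements of degrees \<open>k\<close> and \<open>l\<close>.\<close>

inductive_set prodspan :: "int \<Rightarrow> int \<Rightarrow> (letter, 'k::field) free_algebra set" for k l where
  zero: "0 \<in> prodspan k l"
| add: "f \<in> prodspan k l \<Longrightarrow> g \<in> prodspan k l \<Longrightarrow> f + g \<in> prodspan k l"
| mult: "a \<in> homog word_deg k \<Longrightarrow> b \<in> homog word_deg l \<Longrightarrow> a * b \<in> prodspan k l"

lemma prodspan_sum: "(\<And>a. a \<in> A \<Longrightarrow> f a \<in> prodspan k l) \<Longrightarrow> sum f A \<in> prodspan k l"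
  by (induction A rule: infinite_finite_induct) (simp_all add: prodspan.zero prodspan.add)

lemma prodspan_lmult: "g \<in> prodspan k l \<Longrightarrow> a \<in> homog word_deg i \<Longrightarrow> a * g \<in> prodspan (i + k) l"
  by (induction rule: prodspan.induct)
     (simp_all add: distrib_left prodspan.zero prodspan.add prodspan.mult homog_deg_mult
       flip: mult.assoc)

lemma prodspan_rmult: "g \<in> prodspan k l \<Longrightarrow> b \<in> homog word_deg i \<Longrightarrow> g * b \<in> prodspan k (l + i)"
  by (induction rule: prodspan.induct)
     (simp_all add: distrib_right prodspan.zero prodspan.add prodspan.mult homog_deg_mult mult.assoc)

lemma one_cong_prodspan_add:
  fixes f g :: "(letter, 'k::field) free_algebra"
  assumes f: "f \<in> prodspan k (- k)" "f - 1 \<in> J n" and g: "g \<in> prodspan l (- l)" "g - 1 \<in> J n"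
  shows "\<exists>h\<in>prodspan (l + k) (- (l + k)). h - 1 \<in> (J n :: (letter, 'k) free_algebra set)"
proof -
  have "\<exists>h\<in>prodspan (l + k) (- (l + k)). h - g \<in> J n"
    using g(1)
  proof (induction rule: prodspan.induct)
    case zero
    show ?case by (intro bexI[of _ 0] prodspan.zero) (simp add: J.zero_mem)
  next
    case (add g g')
    then obtain h h' where "h \<in> prodspan (l + k) (- (l + k))" "h - g \<in> J n"
      "h' \<in> prodspan (l + k) (- (l + k))" "h' - g' \<in> J n" by blast
    then show ?case by (intro bexI[of _ "h + h'"] J.cong_add prodspan.add)
  next
    case (mult a b)
    have "a * f * b \<in> prodspan (l + k) (- k + - l)"
      by (intro prodspan_rmult prodspan_lmult f mult)
    moreover have "a * f * b - a * b = a * (f - 1) * b" by (simp add: algebra_simps)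
    ultimately show ?case
      by (intro bexI[of _ "a * f * b"]) (simp_all add: J.lmult_mem J.rmult_mem f add.commute)
  qed
  then obtain h where h: "h \<in> prodspan (l + k) (- (l + k))" "h - g \<in> J n" by blast
  show ?thesis using J.cong_trans[OF h(2) g(2)] h(1) by blast
qed

text \<open>
  In degree \<open>1\<close> use the relation in the upper left corner of \<open>X Y = 1\<close>, and in degree \<open>-1\<close> the relation
  \<open>u\<^sub>0 v\<^sub>0 + \<dots> + u\<^sub>n v\<^sub>n = 1\<close>.
\<close>

lemma one_cong_prodspan:
  assumes "n > 0"
  shows "\<exists>f\<in>prodspan k (- k). f - 1 \<in> (J n :: (letter, 'k::field) free_algebra set)"
proof -
  obtain p :: "(letter, 'k) free_algebra" where pos: "p \<in> prodspan 1 (- 1)" "p - 1 \<in> J n"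
  proof
    show "q n 0 0 - 1 \<in> (J n :: (letter, 'k) free_algebra set)" using q_cong_J[of n 0 0] assms by simp
    have "mon [Lx 0 r] * mon [Ly r 0] \<in> (prodspan 1 (- 1) :: (letter, 'k) free_algebra set)" for r
      by (intro prodspan.mult homog_single) (simp_all add: deg_letter_def)
    then show "q n 0 0 \<in> (prodspan 1 (- 1) :: (letter, 'k) free_algebra set)" unfolding q_def by (intro prodspan_sum) simp
  qed
  obtain m :: "(letter, 'k) free_algebra" where neg: "m \<in> prodspan (- 1) (- (- 1))" "m - 1 \<in> J n"
  proof
    show "(\<Sum>i\<le>n. mon [Lu i, Lv i]) - 1 \<in> (J n :: (letter, 'k) free_algebra set)"
      by (rule uv_cong_J)
    have "mon [Lu i] * mon [Lv i] \<in> (prodspan (- 1) (- (- 1)) :: (letter, 'k) free_algebra set)" for i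
      by (intro prodspan.mult homog_single) (simp_all add: deg_letter_def)
    then show "(\<Sum>i\<le>n. mon [Lu i, Lv i]) \<in> (prodspan (- 1) (- (- 1)) :: (letter, 'k) free_algebra set)"
      by (intro prodspan_sum) simp
  qed
  show ?thesis
  proof (induction k rule: int_induct[of _ 0])
    case base
    have "1 * 1 \<in> (prodspan 0 (- 0) :: (letter, 'k) free_algebra set)" using homog_deg_one by (intro prodspan.mult) simp_all
    then show ?case by (intro bexI[of _ 1]) (simp_all add: J.zero_mem)
  next
    case (step1 i)
    then obtain f :: "(letter, 'k) free_algebra" where f: "f \<in> prodspan i (- i)" "f - 1 \<in> J n" by blast
    from one_cong_prodspan_add[OF pos f] show ?case .
  next
    case (step2 i)
    then obtain f :: "(letter, 'k) free_algebra" where f: "f \<in> prodspan i (- i)" "f - 1 \<in> J n" by blast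
    from one_cong_prodspan_add[OF neg f] show ?case by simp
  qed
qed

text \<open>This is the strongness of the grading of the quotient by \<open>J n\<close>.\<close>

lemma homog_cong_prodspan:
  fixes f :: "(letter, 'k::field) free_algebra"
  assumes "n > 0" "f \<in> homog word_deg (k + l)"
  shows "\<exists>g\<in>prodspan k l. g - f \<in> J n"
proof -
  obtain g :: "(letter, 'k) free_algebra" where g: "g \<in> prodspan k (- k)" "g - 1 \<in> J n"
    using one_cong_prodspan[OF assms(1)] by blast
  have "g * f \<in> prodspan k (- k + (k + l))" by (intro prodspan_rmult g assms)
  moreover have "g * f - f = (g - 1) * f" by (simp add: algebra_simps)
  ultimately show ?thesis by (intro bexI[of _ "g * f"]) (simp_all add: J.rmult_mem g)
qed

section \<open>Epimorphisms of free modules and matrices\<close>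

context ring
begin

lemma carrier_free_right_module: "carrier (free_right_module R a) = {..<a} \<rightarrow>\<^sub>E carrier R"
  by (simp add: free_right_module_def)

lemma add_free_right_module:
  "x \<oplus>\<^bsub>free_right_module R a\<^esub> y = (\<lambda>i\<in>{..<a}. x i \<oplus> y i)"
  by (simp add: free_right_module_def)

lemma rsmult_free_right_module:
  "x \<bullet>\<^bsub>free_right_module R a\<^esub> r = (\<lambda>i\<in>{..<a}. x i \<otimes> r)"
  by (simp add: free_right_module_def)

lemma finsum_swap:
  assumes "finite A" "finite B" "\<And>a b. a \<in> A \<Longrightarrow> b \<in> B \<Longrightarrow> f a b \<in> carrier R"
  shows "(\<Oplus>a\<in>A. \<Oplus>b\<in>B. f a b) = (\<Oplus>b\<in>B. \<Oplus>a\<in>A. f a b)"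
  using assms(1,3)
proof (induction A rule: finite_induct)
  case (insert a A)
  have "(\<Oplus>b\<in>B. \<Oplus>a\<in>insert a A. f a b) = (\<Oplus>b\<in>B. f a b \<oplus> (\<Oplus>a\<in>A. f a b))"
    using insert by (intro finsum_cong') (auto simp: finsum_insert Pi_iff intro!: finsum_closed)
  also have "\<dots> = (\<Oplus>b\<in>B. f a b) \<oplus> (\<Oplus>b\<in>B. \<Oplus>a\<in>A. f a b)"
    using insert.prems by (intro finsum_addf) (auto intro!: finsum_closed)
  finally show ?case using insert by (simp add: finsum_insert Pi_iff finsum_closed)
qed simp

lemma finsum_unit_vector:
  fixes j b :: nat
  assumes "j < b" "\<And>l. l < b \<Longrightarrow> y l \<in> carrier R"
  shows "(\<Oplus>l\<in>{..<b}. (if j = l then \<one> else \<zero>) \<otimes> y l) = y j"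
proof -
  have "(\<Oplus>l\<in>{..<b}. (if j = l then \<one> else \<zero>) \<otimes> y l) = (\<Oplus>l\<in>{..<b}. if j = l then y l else \<zero>)"
    using assms by (intro finsum_cong') auto
  also have "\<dots> = y j" using assms by (intro add.finprod_singleton) auto
  finally show ?thesis .
qed

text \<open>A homomorphism of free modules is the left multiplication by a matrix.\<close>

lemma hom_free_right_module:
  assumes f: "f \<in> right_module_hom R (free_right_module R a) (free_right_module R b)"
    and x: "x \<in> carrier (free_right_module R a)" and i: "i < b"
  shows "f x i = (\<Oplus>l\<in>{..<a}. f (\<lambda>k\<in>{..<a}. if k = l then \<one> else \<zero>) i \<otimes> x l)"
proof -
  define e where "e l = (\<lambda>k\<in>{..<a}. if k = l then \<one> else \<zero>)" for l
  \<comment> \<open>The vector \<open>x\<close> truncated to its first \<open>m\<close> coordinates.\<close>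
  define t where "t m = (\<lambda>k\<in>{..<a}. if k < m then x k else \<zero>)" for m
  have xc: "x k \<in> carrier R" if "k < a" for k using x that by (auto simp: carrier_free_right_module)
  have ec: "e l \<in> carrier (free_right_module R a)" for l
    by (auto simp: e_def carrier_free_right_module)
  have tc: "t m \<in> carrier (free_right_module R a)" for m
    using xc by (auto simp: t_def carrier_free_right_module)
  have f_add: "f (u \<oplus>\<^bsub>free_right_module R a\<^esub> v) = f u \<oplus>\<^bsub>free_right_module R b\<^esub> f v"
    if "u \<in> carrier (free_right_module R a)" "v \<in> carrier (free_right_module R a)" for u v
    using f that by (simp add: right_module_hom_def)
  have f_smult: "f (u \<bullet>\<^bsub>free_right_module R a\<^esub> r) = f u \<bullet>\<^bsub>free_right_module R b\<^esub> r"
    if "u \<in> carrier (free_right_module R a)" "r \<in> carrier R" for u r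
    using f that by (simp add: right_module_hom_def)
  have fc: "f u i \<in> carrier R" if "u \<in> carrier (free_right_module R a)" for u
  proof -
    have "f u \<in> {..<b} \<rightarrow>\<^sub>E carrier R"
      using f that by (auto simp: right_module_hom_def carrier_free_right_module)
    then show ?thesis using i by auto
  qed
  have "m \<le> a \<Longrightarrow> f (t m) i = (\<Oplus>l\<in>{..<m}. f (e l) i \<otimes> x l)" for m
  proof (induction m)
    case 0
    \<comment> \<open>The zero vector is mapped to zero because it is a multiple by the scalar zero.\<close>
    have "t 0 = t 0 \<bullet>\<^bsub>free_right_module R a\<^esub> \<zero>"
      by (auto simp: t_def rsmult_free_right_module)
    then have "f (t 0) = f (t 0) \<bullet>\<^bsub>free_right_module R b\<^esub> \<zero>"
      using f_smult[OF tc zero_closed] by metis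
    then have "f (t 0) i = (f (t 0) \<bullet>\<^bsub>free_right_module R b\<^esub> \<zero>) i" by (rule fun_cong)
    then show ?case using i fc[OF tc, of 0] by (simp add: rsmult_free_right_module)
  next
    case (Suc m)
    have "t (Suc m) = t m \<oplus>\<^bsub>free_right_module R a\<^esub> e m \<bullet>\<^bsub>free_right_module R a\<^esub> x m"
      using xc Suc.prems
      by (auto simp: t_def e_def add_free_right_module rsmult_free_right_module fun_eq_iff less_Suc_eq)
    moreover have "e m \<bullet>\<^bsub>free_right_module R a\<^esub> x m \<in> carrier (free_right_module R a)"
      using xc Suc.prems by (auto simp: e_def carrier_free_right_module rsmult_free_right_module)
    moreover have "f (e m \<bullet>\<^bsub>free_right_module R a\<^esub> x m) = f (e m) \<bullet>\<^bsub>free_right_module R b\<^esub> x m"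
      using Suc.prems by (intro f_smult ec xc) simp
    ultimately have "f (t (Suc m)) =
        f (t m) \<oplus>\<^bsub>free_right_module R b\<^esub> f (e m) \<bullet>\<^bsub>free_right_module R b\<^esub> x m"
      using f_add[OF tc] by metis
    then have "f (t (Suc m)) i = f (t m) i \<oplus> f (e m) i \<otimes> x m"
      using i by (simp add: add_free_right_module rsmult_free_right_module)
    also have "\<dots> = (\<Oplus>l\<in>{..<Suc m}. f (e l) i \<otimes> x l)"
      using Suc fc[OF ec] xc
      by (simp add: lessThan_Suc finsum_insert Pi_iff a_comm finsum_closed)
    finally show ?case .
  qed
  from this[of a] have "f (t a) i = (\<Oplus>l\<in>{..<a}. f (e l) i \<otimes> x l)" by simp
  moreover have "t a = x"
    using x by (auto simp: t_def carrier_free_right_module fun_eq_iff PiE_iff extensional_def)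
  ultimately show ?thesis by (simp add: e_def)
qed

text \<open>
  An epimorphism from the free module of rank \<open>a\<close> to the one of rank \<open>b\<close> is the same as a \<open>b \<times> a\<close> matrix
  with a right inverse.
\<close>

lemma right_module_epi_iff:
  "right_module_epi R (free_right_module R a) (free_right_module R b) \<noteq> {} \<longleftrightarrow>
    (\<exists>A B. (\<forall>i<b. \<forall>l<a. A i l \<in> carrier R) \<and> (\<forall>l<a. \<forall>j<b. B l j \<in> carrier R) \<and>
      (\<forall>i<b. \<forall>j<b. (\<Oplus>l\<in>{..<a}. A i l \<otimes> B l j) = (if i = j then \<one> else \<zero>)))"
  (is "?L \<longleftrightarrow> ?R")
proof
  assume ?L
  then obtain f where f: "f \<in> right_module_hom R (free_right_module R a) (free_right_module R b)"
    and surj: "f ` carrier (free_right_module R a) = carrier (free_right_module R b)"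
    by (auto simp: right_module_epi_def)
  define e where "e m l = (\<lambda>k\<in>{..<m}. if k = l then \<one> else \<zero>)" for m l :: nat
  have ec: "e m l \<in> carrier (free_right_module R m)" for m l
    by (auto simp: e_def carrier_free_right_module)
  have "\<exists>x\<in>carrier (free_right_module R a). f x = e b j" for j
    using surj ec[of b j] by (metis imageE)
  then obtain x where x: "\<And>j. x j \<in> carrier (free_right_module R a)" "\<And>j. f (x j) = e b j"
    by metis
  show ?R
  proof (intro exI conjI allI impI)
    fix i l assume "i < b" "l < a"
    have "f (e a l) \<in> {..<b} \<rightarrow>\<^sub>E carrier R"
      using f ec[of a l] by (auto simp: right_module_hom_def carrier_free_right_module)
    then show "f (e a l) i \<in> carrier R" using \<open>i < b\<close> by auto
  next
    fix l j assume "l < a" "j < b"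
    then show "x j l \<in> carrier R" using x(1)[of j] by (auto simp: carrier_free_right_module)
  next
    fix i j assume ij: "i < b" "j < b"
    have "(\<Oplus>l\<in>{..<a}. f (e a l) i \<otimes> x j l) = f (x j) i"
      using hom_free_right_module[OF f x(1) ij(1)] by (simp add: e_def)
    also have "\<dots> = (if i = j then \<one> else \<zero>)" using ij by (simp add: x e_def)
    finally show "(\<Oplus>l\<in>{..<a}. f (e a l) i \<otimes> x j l) = (if i = j then \<one> else \<zero>)" .
  qed
next
  assume ?R
  then obtain A B where "\<forall>i<b. \<forall>l<a. A i l \<in> carrier R" "\<forall>l<a. \<forall>j<b. B l j \<in> carrier R"
    "\<forall>i<b. \<forall>j<b. (\<Oplus>l\<in>{..<a}. A i l \<otimes> B l j) = (if i = j then \<one> else \<zero>)"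
    by (elim exE conjE) (rule that)
  then have A: "\<And>i l. i < b \<Longrightarrow> l < a \<Longrightarrow> A i l \<in> carrier R"
    and B: "\<And>l j. l < a \<Longrightarrow> j < b \<Longrightarrow> B l j \<in> carrier R"
    and AB: "\<And>i j. i < b \<Longrightarrow> j < b \<Longrightarrow> (\<Oplus>l\<in>{..<a}. A i l \<otimes> B l j) = (if i = j then \<one> else \<zero>)"
    by simp_all
  define f where "f x = (\<lambda>i\<in>{..<b}. \<Oplus>l\<in>{..<a}. A i l \<otimes> x l)" for x
  have xc: "x l \<in> carrier R" if "x \<in> carrier (free_right_module R m)" "l < m" for x l m
    using that by (auto simp: carrier_free_right_module)
  have f_hom: "f \<in> right_module_hom R (free_right_module R a) (free_right_module R b)"
    unfolding right_module_hom_def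
  proof (intro CollectI conjI ballI funcsetI)
    fix x assume x: "x \<in> carrier (free_right_module R a)"
    then show "f x \<in> carrier (free_right_module R b)"
      using A xc[OF x] by (auto simp: f_def carrier_free_right_module intro!: finsum_closed)
    fix y assume y: "y \<in> carrier (free_right_module R a)"
    have "(\<Oplus>l\<in>{..<a}. A i l \<otimes> (x \<oplus>\<^bsub>free_right_module R a\<^esub> y) l) =
        (\<Oplus>l\<in>{..<a}. A i l \<otimes> x l) \<oplus> (\<Oplus>l\<in>{..<a}. A i l \<otimes> y l)" if "i < b" for i
    proof -
      have "(\<Oplus>l\<in>{..<a}. A i l \<otimes> (x \<oplus>\<^bsub>free_right_module R a\<^esub> y) l) =
          (\<Oplus>l\<in>{..<a}. A i l \<otimes> x l \<oplus> A i l \<otimes> y l)"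
        using A[OF that] xc[OF x] xc[OF y]
        by (intro finsum_cong') (auto simp: add_free_right_module r_distr)
      also have "\<dots> = (\<Oplus>l\<in>{..<a}. A i l \<otimes> x l) \<oplus> (\<Oplus>l\<in>{..<a}. A i l \<otimes> y l)"
        using A[OF that] xc[OF x] xc[OF y] by (intro finsum_addf) auto
      finally show ?thesis .
    qed
    then show "f (x \<oplus>\<^bsub>free_right_module R a\<^esub> y) = f x \<oplus>\<^bsub>free_right_module R b\<^esub> f y"
      by (auto simp: f_def add_free_right_module[where a = b])
  next
    fix x r assume x: "x \<in> carrier (free_right_module R a)" and r: "r \<in> carrier R"
    have "(\<Oplus>l\<in>{..<a}. A i l \<otimes> (x \<bullet>\<^bsub>free_right_module R a\<^esub> r) l) = (\<Oplus>l\<in>{..<a}. A i l \<otimes> x l) \<otimes> r"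
      if "i < b" for i
    proof -
      have "(\<Oplus>l\<in>{..<a}. A i l \<otimes> (x \<bullet>\<^bsub>free_right_module R a\<^esub> r) l) = (\<Oplus>l\<in>{..<a}. A i l \<otimes> x l \<otimes> r)"
        using A[OF that] xc[OF x] r
        by (intro finsum_cong') (auto simp: rsmult_free_right_module m_assoc)
      also have "\<dots> = (\<Oplus>l\<in>{..<a}. A i l \<otimes> x l) \<otimes> r"
        using A[OF that] xc[OF x] r by (intro finsum_ldistr[symmetric]) auto
      finally show ?thesis .
    qed
    then show "f (x \<bullet>\<^bsub>free_right_module R a\<^esub> r) = f x \<bullet>\<^bsub>free_right_module R b\<^esub> r"
      by (auto simp: f_def rsmult_free_right_module[where a = b])
  qed
  have "y \<in> f ` carrier (free_right_module R a)" if y: "y \<in> carrier (free_right_module R b)" for y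
  proof
    define x where "x = (\<lambda>l\<in>{..<a}. \<Oplus>j\<in>{..<b}. B l j \<otimes> y j)"
    show x: "x \<in> carrier (free_right_module R a)"
      using B xc[OF y] by (auto simp: x_def carrier_free_right_module intro!: finsum_closed)
    have "f x i = y i" if i: "i < b" for i
    proof -
      have "f x i = (\<Oplus>l\<in>{..<a}. A i l \<otimes> (\<Oplus>j\<in>{..<b}. B l j \<otimes> y j))"
        using i A[OF i] B xc[OF y]
        by (simp add: f_def) (intro finsum_cong', auto simp: x_def intro!: finsum_closed)
      also have "\<dots> = (\<Oplus>l\<in>{..<a}. \<Oplus>j\<in>{..<b}. A i l \<otimes> B l j \<otimes> y j)"
        using A[OF i] B xc[OF y]
        by (intro finsum_cong') (auto simp: finsum_rdistr m_assoc Pi_iff intro!: finsum_closed finsum_cong')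
      also have "\<dots> = (\<Oplus>j\<in>{..<b}. \<Oplus>l\<in>{..<a}. A i l \<otimes> B l j \<otimes> y j)"
        using A[OF i] B xc[OF y] by (intro finsum_swap) auto
      also have "\<dots> = (\<Oplus>j\<in>{..<b}. (if i = j then \<one> else \<zero>) \<otimes> y j)"
      proof (intro finsum_cong' refl)
        fix j assume j: "j \<in> {..<b}"
        have "(\<Oplus>l\<in>{..<a}. A i l \<otimes> B l j \<otimes> y j) = (\<Oplus>l\<in>{..<a}. A i l \<otimes> B l j) \<otimes> y j"
          using A[OF i] B xc[OF y] j by (intro finsum_ldistr[symmetric]) auto
        then show "(\<Oplus>l\<in>{..<a}. A i l \<otimes> B l j \<otimes> y j) = (if i = j then \<one> else \<zero>) \<otimes> y j"
          using AB i j by simp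
      qed (use xc[OF y] in auto)
      also have "\<dots> = y i" using i xc[OF y] by (intro finsum_unit_vector)
      finally show ?thesis .
    qed
    then show "y = f x"
      using y by (auto simp: f_def carrier_free_right_module PiE_iff extensional_def fun_eq_iff)
  qed
  then have "f \<in> right_module_epi R (free_right_module R a) (free_right_module R b)"
    using f_hom by (auto simp: right_module_epi_def right_module_hom_def)
  then show ?L by blast
qed

end

section \<open>Countable residue class rings\<close>

text \<open>
  A ring that is presented as the image of a subring \<open>D\<close> of a type class ring under a homomorphism \<open>c\<close>
  whose fibres on \<open>D\<close> are the congruence classes modulo \<open>I\<close>.
\<close>

locale presented_ring = ring R for R (structure) +
  fixes c :: "'r::ring_1 \<Rightarrow> 'a" and D I
  assumes carrier_eq: "carrier R = c ` D"
    and D_zero: "0 \<in> D" and D_one: "1 \<in> D"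
    and D_add: "f \<in> D \<Longrightarrow> g \<in> D \<Longrightarrow> f + g \<in> D"
    and D_mult: "f \<in> D \<Longrightarrow> g \<in> D \<Longrightarrow> f * g \<in> D"
    and c_zero: "c 0 = \<zero>" and c_one: "c 1 = \<one>"
    and c_add: "f \<in> D \<Longrightarrow> g \<in> D \<Longrightarrow> c (f + g) = c f \<oplus> c g"
    and c_mult: "f \<in> D \<Longrightarrow> g \<in> D \<Longrightarrow> c (f * g) = c f \<otimes> c g"
    and c_eq_iff: "f \<in> D \<Longrightarrow> g \<in> D \<Longrightarrow> c f = c g \<longleftrightarrow> f - g \<in> I"
begin

lemma D_sum: "(\<And>a. a \<in> A \<Longrightarrow> F a \<in> D) \<Longrightarrow> sum F A \<in> D"
  by (induction A rule: infinite_finite_induct) (simp_all add: D_zero D_add)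

lemma c_closed: "f \<in> D \<Longrightarrow> c f \<in> carrier R"
  by (simp add: carrier_eq)

lemma c_sum: "(\<And>a. a \<in> A \<Longrightarrow> F a \<in> D) \<Longrightarrow> c (sum F A) = (\<Oplus>a\<in>A. c (F a))"
proof (induction A rule: infinite_finite_induct)
  case (insert a A)
  then have "c (sum F (insert a A)) = c (F a) \<oplus> c (sum F A)" by (simp add: c_add D_sum)
  then show ?case using insert by (simp add: finsum_insert c_closed Pi_iff)
qed (simp_all add: c_zero finsum_infinite)

lemma right_module_epi_iff_presented:
  "right_module_epi R (free_right_module R a) (free_right_module R b) \<noteq> {} \<longleftrightarrow>
    (\<exists>A B. (\<forall>i l. A i l \<in> D) \<and> (\<forall>l j. B l j \<in> D) \<and>
      (\<forall>i<b. \<forall>j<b. (\<Sum>l<a. A i l * B l j) - (if i = j then 1 else 0) \<in> I))"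
  (is "?L \<longleftrightarrow> ?R")
proof -
  have key: "(\<Sum>l<a. A i l * B l j) - (if i = j then 1 else 0) \<in> I \<longleftrightarrow>
      (\<Oplus>l\<in>{..<a}. c (A i l) \<otimes> c (B l j)) = (if i = j then \<one> else \<zero>)"
    if "\<And>i l. A i l \<in> D" "\<And>l j. B l j \<in> D" for A B :: "nat \<Rightarrow> nat \<Rightarrow> 'r" and i j
  proof -
    have "(\<Oplus>l\<in>{..<a}. c (A i l) \<otimes> c (B l j)) = c (\<Sum>l<a. A i l * B l j)"
      using that by (simp add: c_sum c_mult D_mult)
    moreover have "(if i = j then \<one> else \<zero>) = c (if i = j then 1 else 0)"
      by (simp add: c_zero c_one)
    moreover have "(\<Sum>l<a. A i l * B l j) \<in> D" "(if i = j then 1 else 0) \<in> D"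
      using that by (simp_all add: D_sum D_mult D_one D_zero)
    ultimately show ?thesis by (simp only: c_eq_iff)
  qed
  show ?thesis
  proof
    assume ?L
    then obtain A B where "\<forall>i<b. \<forall>l<a. A i l \<in> carrier R" "\<forall>l<a. \<forall>j<b. B l j \<in> carrier R"
      "\<forall>i<b. \<forall>j<b. (\<Oplus>l\<in>{..<a}. A i l \<otimes> B l j) = (if i = j then \<one> else \<zero>)"
      unfolding right_module_epi_iff by (elim exE conjE) (rule that)
    then have A: "\<And>i l. i < b \<Longrightarrow> l < a \<Longrightarrow> A i l \<in> carrier R"
      and B: "\<And>l j. l < a \<Longrightarrow> j < b \<Longrightarrow> B l j \<in> carrier R"
      and AB: "\<And>i j. i < b \<Longrightarrow> j < b \<Longrightarrow> (\<Oplus>l\<in>{..<a}. A i l \<otimes> B l j) = (if i = j then \<one> else \<zero>)"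
      by simp_all
    define r where "r x = (if x \<in> carrier R then SOME f. f \<in> D \<and> c f = x else 0)" for x
    have r: "r x \<in> D" "x \<in> carrier R \<Longrightarrow> c (r x) = x" for x
    proof -
      have *: "r x \<in> D \<and> c (r x) = x" if x: "x \<in> carrier R"
      proof -
        have "\<exists>f. f \<in> D \<and> c f = x" using x carrier_eq by auto
        from someI_ex[OF this] show ?thesis using x by (simp add: r_def)
      qed
      then show "x \<in> carrier R \<Longrightarrow> c (r x) = x" by blast
      show "r x \<in> D"
      proof (cases "x \<in> carrier R")
        case False
        then show ?thesis by (simp add: r_def D_zero)
      qed (use * in blast)
    qed
    have ABI: "(\<Sum>l<a. r (A i l) * r (B l j)) - (if i = j then 1 else 0) \<in> I" if ij: "i < b" "j < b" for i j
    proof -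
      have "(\<Oplus>l\<in>{..<a}. c (r (A i l)) \<otimes> c (r (B l j))) = (\<Oplus>l\<in>{..<a}. A i l \<otimes> B l j)"
        using ij A B by (intro finsum_cong') (auto simp: r)
      then show ?thesis using ij AB by (subst key) (simp_all add: r)
    qed
    show ?R
      by (rule exI[of _ "\<lambda>i l. r (A i l)"], rule exI[of _ "\<lambda>l j. r (B l j)"])
         (intro conjI allI impI r(1) ABI)
  next
    assume ?R
    then obtain A B where "\<forall>i l. A i l \<in> D" "\<forall>l j. B l j \<in> D"
      "\<forall>i<b. \<forall>j<b. (\<Sum>l<a. A i l * B l j) - (if i = j then 1 else 0) \<in> I"
      by (elim exE conjE) (rule that)
    then have A: "\<And>i l. A i l \<in> D" and B: "\<And>l j. B l j \<in> D"
      and AB: "\<And>i j. i < b \<Longrightarrow> j < b \<Longrightarrow> (\<Sum>l<a. A i l * B l j) - (if i = j then 1 else 0) \<in> I"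
      by simp_all
    show ?L unfolding right_module_epi_iff
      by (rule exI[of _ "\<lambda>i l. c (A i l)"], rule exI[of _ "\<lambda>l j. c (B l j)"])
         (intro conjI allI impI c_closed A B key[OF A B, THEN iffD1, OF AB])
  qed
qed

end

text \<open>
  The quotient of a countable ring by an ideal, with residue classes encoded by natural numbers. The
  code of the class of \<open>f\<close> is the number of a representative that depends on the class only.
\<close>

definition residue :: "'a::ring_1 set \<Rightarrow> 'a \<Rightarrow> nat" where
  "residue I f = to_nat_on UNIV (SOME g. g - f \<in> I)"

text \<open>A representative of the residue class with the given code.\<close>

definition residue_rep :: "'a::ring_1 set \<Rightarrow> nat \<Rightarrow> 'a" where
  "residue_rep I x = (SOME f. residue I f = x)"

definition residue_class_ring :: "'a::ring_1 set \<Rightarrow> nat ring" where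
  "residue_class_ring I =
    \<lparr>carrier = range (residue I),
     monoid.mult = (\<lambda>x y. residue I (residue_rep I x * residue_rep I y)),
     one = residue I 1,
     ring.zero = residue I 0,
     ring.add = (\<lambda>x y. residue I (residue_rep I x + residue_rep I y))\<rparr>"

locale countable_ideal = two_sided_ideal I for I :: "'a::ring_1 set" +
  assumes countable: "countable (UNIV :: 'a set)"
begin

lemma residue_eq_iff: "residue I f = residue I g \<longleftrightarrow> f - g \<in> I"
proof
  have some: "(SOME g. g - f \<in> I) - f \<in> I" for f
    by (rule someI[of _ f]) (simp add: zero_mem)
  assume "residue I f = residue I g"
  then have "(SOME h. h - f \<in> I) = (SOME h. h - g \<in> I)"
    using inj_on_to_nat_on[OF countable] by (simp add: residue_def inj_eq)
  then have "(SOME h. h - f \<in> I) - g \<in> I" using some[of g] by simp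
  with cong_sym[OF some[of f]] show "f - g \<in> I" by (rule cong_trans)
next
  assume "f - g \<in> I"
  then have "h - f \<in> I \<longleftrightarrow> h - g \<in> I" for h
    using cong_trans[of h f g] cong_trans[of h g f] cong_sym[of f g] by blast
  then show "residue I f = residue I g" by (simp add: residue_def)
qed

lemma residue_rep: "residue_rep I (residue I f) - f \<in> I"
proof -
  have "residue I (residue_rep I (residue I f)) = residue I f"
    unfolding residue_rep_def by (rule someI[of _ f]) simp
  then show ?thesis by (simp add: residue_eq_iff)
qed

lemma residue_ring_simps [simp]:
  "carrier (residue_class_ring I) = range (residue I)"
  "\<one>\<^bsub>residue_class_ring I\<^esub> = residue I 1"
  "\<zero>\<^bsub>residue_class_ring I\<^esub> = residue I 0"
  "residue I f \<otimes>\<^bsub>residue_class_ring I\<^esub> residue I g = residue I (f * g)"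
  "residue I f \<oplus>\<^bsub>residue_class_ring I\<^esub> residue I g = residue I (f + g)"
  using cong_mult[OF residue_rep residue_rep] cong_add[OF residue_rep residue_rep]
  by (simp_all add: residue_class_ring_def residue_eq_iff)

lemma ring_residue_class_ring: "ring (residue_class_ring I)"
proof (rule ringI)
  show "abelian_group (residue_class_ring I)"
  proof (rule abelian_groupI)
    fix x assume "x \<in> carrier (residue_class_ring I)"
    then obtain f where "x = residue I f" by auto
    then show "\<exists>y\<in>carrier (residue_class_ring I).
        y \<oplus>\<^bsub>residue_class_ring I\<^esub> x = \<zero>\<^bsub>residue_class_ring I\<^esub>"
      by (intro bexI[of _ "residue I (- f)"]) simp_all
  qed (auto simp: ac_simps)
  show "Group.monoid (residue_class_ring I)"
    by (rule Group.monoidI) (auto simp: mult.assoc)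
  fix x y z
  assume "x \<in> carrier (residue_class_ring I)" "y \<in> carrier (residue_class_ring I)"
    "z \<in> carrier (residue_class_ring I)"
  then obtain f g h where "x = residue I f" "y = residue I g" "z = residue I h" by auto
  then show "(x \<oplus>\<^bsub>residue_class_ring I\<^esub> y) \<otimes>\<^bsub>residue_class_ring I\<^esub> z =
      x \<otimes>\<^bsub>residue_class_ring I\<^esub> z \<oplus>\<^bsub>residue_class_ring I\<^esub> y \<otimes>\<^bsub>residue_class_ring I\<^esub> z"
    and "z \<otimes>\<^bsub>residue_class_ring I\<^esub> (x \<oplus>\<^bsub>residue_class_ring I\<^esub> y) =
      z \<otimes>\<^bsub>residue_class_ring I\<^esub> x \<oplus>\<^bsub>residue_class_ring I\<^esub> z \<otimes>\<^bsub>residue_class_ring I\<^esub> y"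
    by (simp_all add: distrib_left distrib_right)
qed

sublocale residue: presented_ring "residue_class_ring I" "residue I" UNIV I
  by (intro presented_ring.intro presented_ring_axioms.intro ring_residue_class_ring)
     (auto simp: residue_eq_iff)

end

section \<open>The strongly graded ring\<close>

instance letter :: countable
  by countable_datatype

interpretation R: countable_ideal "J n :: (letter, bit) free_algebra set"
  by (intro countable_ideal.intro countable_ideal_axioms.intro J.two_sided_ideal_axioms
      countable_poly_mapping_bit)

text \<open>The graded ring and its homogeneous components.\<close>

definition example_ring :: "nat \<Rightarrow> nat ring" where
  "example_ring n = residue_class_ring (J n :: (letter, bit) free_algebra set)"

definition example_component :: "nat \<Rightarrow> int \<Rightarrow> nat set" where
  "example_component n k = residue (J n :: (letter, bit) free_algebra set) ` homog word_deg k"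

lemma a_inv_residue:
  fixes f :: "(letter, bit) free_algebra"
  shows "\<ominus>\<^bsub>residue_class_ring (J n :: (letter, bit) free_algebra set)\<^esub> residue (J n) f = residue (J n) (- f)"
  by (rule R.residue.minus_equality) auto

lemma strongly_graded_example_ring:
  assumes "n > 0"
  shows "strongly_Z_graded_ring (example_ring n) (example_component n)"
proof -
  let ?J = "J n :: (letter, bit) free_algebra set"
  let ?R = "residue_class_ring ?J"
  let ?c = "residue ?J"
  let ?G = "\<lambda>k. ?c ` homog word_deg k"
  have addG: "additive_subgroup (?G k) ?R" for k
  proof (rule additive_subgroup.intro, rule R.residue.add.subgroupI)
    show "?G k \<subseteq> carrier ?R" by auto
    have "?c 0 \<in> ?G k" by (rule imageI) simp
    then show "?G k \<noteq> {}" by blast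
    show "\<ominus>\<^bsub>?R\<^esub> a \<in> ?G k" if "a \<in> ?G k" for a
      using that by (auto simp: a_inv_residue intro: homog_uminus)
    show "a \<oplus>\<^bsub>?R\<^esub> b \<in> ?G k" if "a \<in> ?G k" "b \<in> ?G k" for a b
      using that by (auto intro: homog_add)
  qed
  have part_J: "f \<in> ?J \<Longrightarrow> part word_deg k f \<in> ?J" for f k
    unfolding J_def by (rule graded_core_part_mem[OF _ H.zero_mem])
  have c_sum: "?c (\<Sum>k\<in>S. e k) = (\<Oplus>\<^bsub>?R\<^esub>k\<in>S. ?c (e k))" for e :: "int \<Rightarrow> _" and S
    by (rule R.residue.c_sum) simp
  have "strongly_Z_graded_ring ?R ?G"
  proof (intro strongly_Z_graded_ring.intro strongly_Z_graded_ring_axioms.intro addG)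
    show "ring ?R" by (rule R.ring_residue_class_ring)
  next
    fix x assume "x \<in> carrier ?R"
    then obtain f where x: "x = ?c f" by auto
    let ?P = "\<lambda>c. (\<forall>k. c k \<in> ?G k) \<and> finite {k. c k \<noteq> \<zero>\<^bsub>?R\<^esub>} \<and>
        x = (\<Oplus>\<^bsub>?R\<^esub>k\<in>{k. c k \<noteq> \<zero>\<^bsub>?R\<^esub>}. c k)"
    show "\<exists>!c. ?P c"
    proof (rule ex1I)
      let ?c' = "\<lambda>k. ?c (part word_deg k f)"
      let ?S = "{k. ?c' k \<noteq> \<zero>\<^bsub>?R\<^esub>}"
      have sub: "?S \<subseteq> word_deg ` keys f"
      proof
        fix k assume k: "k \<in> ?S"
        have "part word_deg k f \<noteq> 0" using k by auto
        then obtain w where "lookup (part word_deg k f) w \<noteq> 0"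
          by (metis poly_mapping_eqI lookup_zero)
        then show "k \<in> word_deg ` keys f" by (auto simp: lookup_part in_keys_iff split: if_splits)
      qed
      have fin: "finite ?S" by (rule finite_subset[OF sub]) simp
      have "f = (\<Sum>k\<in>word_deg ` keys f. part word_deg k f)" by (simp add: sum_part)
      also have "\<dots> = (\<Sum>k\<in>word_deg ` keys f - ?S. part word_deg k f) + (\<Sum>k\<in>?S. part word_deg k f)"
        by (rule sum.subset_diff[OF sub]) simp
      finally have "f - (\<Sum>k\<in>?S. part word_deg k f) = (\<Sum>k\<in>word_deg ` keys f - ?S. part word_deg k f)"
        by (simp add: algebra_simps)
      also have "\<dots> \<in> ?J" by (rule J.sum_mem) (simp add: R.residue_eq_iff)
      finally have "?c f = ?c (\<Sum>k\<in>?S. part word_deg k f)" by (simp add: R.residue_eq_iff)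
      then have x_sum: "x = (\<Oplus>\<^bsub>?R\<^esub>k\<in>?S. ?c' k)" unfolding x c_sum .
      show "?P ?c'" by (intro conjI allI imageI part_in_homog fin x_sum)
    next
      fix d assume d: "?P d"
      then have "\<forall>k. \<exists>e. e \<in> homog word_deg k \<and> d k = ?c e" by blast
      from choice[OF this] obtain e where e: "\<And>k. e k \<in> homog word_deg k" "\<And>k. d k = ?c (e k)" by blast
      define S where "S = {k. d k \<noteq> \<zero>\<^bsub>?R\<^esub>}"
      have S: "finite S" "x = (\<Oplus>\<^bsub>?R\<^esub>k\<in>S. d k)" using d by (simp_all add: S_def)
      have "?c f = ?c (\<Sum>k\<in>S. e k)" using S(2) unfolding x c_sum e(2) .
      then have "f - (\<Sum>k\<in>S. e k) \<in> ?J" by (simp add: R.residue_eq_iff)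
      then have "part word_deg k (f - (\<Sum>k\<in>S. e k)) \<in> ?J" for k by (rule part_J)
      then have "?c (part word_deg k f) = ?c (\<Sum>i\<in>S. part word_deg k (e i))" for k
        by (simp add: R.residue_eq_iff part_diff part_sum)
      moreover have "(\<Sum>i\<in>S. part word_deg k (e i)) = (if k \<in> S then e k else 0)" for k
        using S(1) by (simp add: part_homog[OF e(1)])
      ultimately have "?c (part word_deg k f) = ?c (if k \<in> S then e k else 0)" for k by simp
      then show "d = (\<lambda>k. ?c (part word_deg k f))"
        by (auto simp: fun_eq_iff e(2)[symmetric] S_def)
    qed
  next
    fix k l
    show "generate (add_monoid ?R) (?G k <#>\<^bsub>?R\<^esub> ?G l) = ?G (k + l)"
    proof
      have "?G k <#>\<^bsub>?R\<^esub> ?G l \<subseteq> ?G (k + l)"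
        by (auto simp: set_mult_def intro: homog_deg_mult)
      then show "generate (add_monoid ?R) (?G k <#>\<^bsub>?R\<^esub> ?G l) \<subseteq> ?G (k + l)"
        using additive_subgroup.a_subgroup[OF addG]
        by (rule group.generate_subgroup_incl[OF R.residue.add.is_group])
      have gen: "?c g \<in> generate (add_monoid ?R) (?G k <#>\<^bsub>?R\<^esub> ?G l)" if "g \<in> prodspan k l" for g
        using that
      proof (induction rule: prodspan.induct)
        case zero
        then show ?case using generate.one[of "add_monoid ?R"] by simp
      next
        case (add f g)
        then show ?case using generate.eng[of _ "add_monoid ?R"] by fastforce
      next
        case (mult a b)
        then have "?c (a * b) \<in> ?G k <#>\<^bsub>?R\<^esub> ?G l"
          unfolding set_mult_def using R.residue_ring_simps(4)[of n a b] by (auto simp del: R.residue_ring_simps) metis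
        then show ?case by (rule generate.incl)
      qed
      show "?G (k + l) \<subseteq> generate (add_monoid ?R) (?G k <#>\<^bsub>?R\<^esub> ?G l)"
      proof
        fix x assume "x \<in> ?G (k + l)"
        then obtain f where f: "f \<in> homog word_deg (k + l)" "x = ?c f" by blast
        obtain g where g: "g \<in> prodspan k l" "g - f \<in> ?J"
          using homog_cong_prodspan[OF assms f(1)] by blast
        then have "x = ?c g" using f by (simp add: R.residue_eq_iff J.cong_sym)
        then show "x \<in> generate (add_monoid ?R) (?G k <#>\<^bsub>?R\<^esub> ?G l)" using gen[OF g(1)] by simp
      qed
    qed
  qed
  then show ?thesis by (simp add: example_ring_def example_component_def[abs_def])
qed

lemma right_module_epi_example_ring_iff:
  "right_module_epi (example_ring n) (free_right_module (example_ring n) a) (free_right_module (example_ring n) b) \<noteq> {} \<longleftrightarrow>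
    (\<exists>A B. \<forall>i<b. \<forall>j<b. (\<Sum>l<a. A i l * B l j) - (if i = j then 1 else 0) \<in>
      (J n :: (letter, bit) free_algebra set))"
  unfolding example_ring_def by (subst R.residue.right_module_epi_iff_presented) simp

lemma UGN_base_example_ring:
  assumes "n > 0"
  shows "UGN (base_ring (example_ring n) (example_component n))"
  unfolding UGN_def
proof (intro allI impI)
  let ?J = "J n :: (letter, bit) free_algebra set"
  let ?S = "base_ring (example_ring n) (example_component n)"
  interpret S: presented_ring ?S "residue ?J" "homog word_deg 0" ?J
  proof (intro presented_ring.intro presented_ring_axioms.intro)
    show "ring ?S"
      by (rule strongly_Z_graded_ring.ring_base_ring[OF strongly_graded_example_ring[OF assms]])
    show "f * g \<in> homog word_deg 0" if "f \<in> homog word_deg 0" "g \<in> homog word_deg 0"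
      for f g :: "(letter, bit) free_algebra"
      using homog_deg_mult[OF that] by simp
  qed (auto simp: base_ring_def example_ring_def example_component_def R.residue_eq_iff homog_deg_one homog_add)
  fix k :: nat assume "k > 0"
  show "right_module_epi ?S (free_right_module ?S k) (free_right_module ?S (k + 1)) = {}"
  proof (rule ccontr)
    assume "\<not> ?thesis"
    then obtain A B where "\<forall>i l. A i l \<in> homog word_deg 0" "\<forall>l j. B l j \<in> homog word_deg 0"
      "\<forall>i<k + 1. \<forall>j<k + 1. (\<Sum>l<k. A i l * B l j) - (if i = j then 1 else 0) \<in> ?J"
      unfolding S.right_module_epi_iff_presented by (elim exE conjE) (rule that)
    then have A: "\<And>i l. A i l \<in> homog word_deg 0" and B: "\<And>l j. B l j \<in> homog word_deg 0"
      and AB: "\<And>i j. i < k + 1 \<Longrightarrow> j < k + 1 \<Longrightarrow> (\<Sum>l<k. A i l * B l j) - (if i = j then 1 else 0) \<in> ?J"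
      by simp_all
    show False
    proof (rule no_identity_factorization_degree_zero[OF A B])
      fix i j assume "i \<le> k" "j \<le> k"
      then show "(\<Sum>l<k. A i l * B l j) - (if i = j then 1 else 0) \<in> annih n"
        using subsetD[OF J_subset_H AB[of i j]] by (simp add: H_def)
    qed
  qed
qed

lemma gn_example_ring:
  assumes "n > 0"
  shows "gn (example_ring n) = enat n"
proof -
  let ?E = "\<lambda>k. right_module_epi (example_ring n) (free_right_module (example_ring n) k) (free_right_module (example_ring n) (k + 1))"
  have epi: "?E n \<noteq> {}"
    unfolding right_module_epi_example_ring_iff
  proof (intro exI allI impI)
    fix i j assume "i < n + 1" "j < n + 1"
    then show "(\<Sum>l<n. mon [Lx i l] * mon [Ly l j]) - (if i = j then 1 else 0) \<in>
        (J n :: (letter, bit) free_algebra set)"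
      using q_cong_J[OF assms, of i j] by (simp add: q_def)
  qed
  have "k \<ge> n" if "?E k \<noteq> {}" for k
  proof (rule ccontr)
    assume "\<not> n \<le> k"
    from \<open>?E k \<noteq> {}\<close> obtain A B where
      "\<forall>i<k + 1. \<forall>j<k + 1. (\<Sum>l<k. A i l * B l j) - (if i = j then 1 else 0) \<in>
        (J n :: (letter, bit) free_algebra set)"
      unfolding right_module_epi_example_ring_iff by (elim exE) (rule that)
    with \<open>\<not> n \<le> k\<close> show False using no_identity_factorization_J[of k n A B] by simp
  qed
  then have "(LEAST k. k > 0 \<and> ?E k \<noteq> {}) = n"
    using assms epi by (intro Least_equality) auto
  moreover have "\<not> UGN (example_ring n)" using assms epi by (auto simp: UGN_def)
  ultimately show ?thesis by (simp add: gn_def)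
qed

theorem theorem4p2:
  fixes n :: nat
  assumes "n > 0"
  shows "\<exists>(R :: nat ring) G. strongly_Z_graded_ring R G \<and> UGN (base_ring R G) \<and> gn R = enat n"
  using strongly_graded_example_ring[OF assms] UGN_base_example_ring[OF assms] gn_example_ring[OF assms] by blast

end
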